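(* Let $R$ be a commutative ring with identity, and let $\alpha\colon K\to G$ and $\beta\colon H\to G$ be two homomorphisms of finite groups. For any $x\in G$, set \[ {}^{x}\alpha\colon K\to G,\quad k\mapsto x\alpha(k)x^{-1}, \] and let \[ B_x=\{(k,h)\in K\times H \mid {}^{x}\alpha(k)=\beta(h)\} \] be the pullback of ${}^{x}\alpha$ and $\beta$, with projections $\gamma_x\colon B_x\to K$, $(k,h)\mapsto k$, and $\delta_x\colon B_x\to H$, $(k,h)\mapsto h$. Then for any $RK$-module $V$ there is an isomorphism of $RH$-modules \[ \mathrm{Res}_\beta\,\mathrm{Ind}_\alpha V\;\cong\;\bigoplus_{x\in[\beta(H)\backslash G/\alpha(K)]}\mathrm{Ind}_{\delta_x}\mathrm{Res}_{\gamma_x}V. \]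
   Context: Modules are left modules. For a homomorphism $\varphi\colon G\to G_1$ of finite groups (not necessarily injective), $RG_1$ is viewed as a right $RG$-module via $\varphi$. For an $RG$-module $V$, the non-injective induction is the $RG_1$-module $\mathrm{Ind}_\varphi V = RG_1\otimes_{RG}V$. For an $RG_1$-module $V_1$, the non-injective restriction $\mathrm{Res}_\varphi V_1$ is $V_1$ viewed as an $RG$-module with $g\in G$ acting as $\varphi(g)$. $[\beta(H)\backslash G/\alpha(K)]$ denotes a set of representatives in $G$ of the double cosets $\beta(H)x\alpha(K)$. *)

theory Defs
  imports "HOL-Algebra.Algebra"
begin

section \<open>Modules over a ring that need not be commutative\<close>

text \<open>
  The library locale \<open>module\<close> requires a commutative ring of scalars, whereas group rings are not
  commutative in general. The record \<open>module\<close> is reused; it inherits the fields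
  \<open>mult\<close> and \<open>one\<close> from \<open>ring\<close>, which carry no meaning for a module and are set to
  \<open>undefined\<close> in the constructions below.
\<close>

locale left_module = R?: ring R + M?: abelian_group M
  for R :: "('a, 'm) ring_scheme" (structure) and M :: "('a, 'b, 'n) module_scheme" (structure) +
  assumes smult_closed:
      "\<lbrakk>a \<in> carrier R; x \<in> carrier M\<rbrakk> \<Longrightarrow> a \<odot>\<^bsub>M\<^esub> x \<in> carrier M"
    and smult_l_distr:
      "\<lbrakk>a \<in> carrier R; b \<in> carrier R; x \<in> carrier M\<rbrakk> \<Longrightarrow>
        (a \<oplus>\<^bsub>R\<^esub> b) \<odot>\<^bsub>M\<^esub> x = (a \<odot>\<^bsub>M\<^esub> x) \<oplus>\<^bsub>M\<^esub> (b \<odot>\<^bsub>M\<^esub> x)"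
    and smult_r_distr:
      "\<lbrakk>a \<in> carrier R; x \<in> carrier M; y \<in> carrier M\<rbrakk> \<Longrightarrow>
        a \<odot>\<^bsub>M\<^esub> (x \<oplus>\<^bsub>M\<^esub> y) = (a \<odot>\<^bsub>M\<^esub> x) \<oplus>\<^bsub>M\<^esub> (a \<odot>\<^bsub>M\<^esub> y)"
    and smult_assoc:
      "\<lbrakk>a \<in> carrier R; b \<in> carrier R; x \<in> carrier M\<rbrakk> \<Longrightarrow>
        (a \<otimes>\<^bsub>R\<^esub> b) \<odot>\<^bsub>M\<^esub> x = a \<odot>\<^bsub>M\<^esub> (b \<odot>\<^bsub>M\<^esub> x)"
    and smult_one:
      "x \<in> carrier M \<Longrightarrow> \<one>\<^bsub>R\<^esub> \<odot>\<^bsub>M\<^esub> x = x"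

definition left_module_hom ::
  "('a, 'm) ring_scheme \<Rightarrow> ('a, 'b, 'n) module_scheme \<Rightarrow> ('a, 'c, 'o) module_scheme \<Rightarrow> ('b \<Rightarrow> 'c) set"
  where
  "left_module_hom R M N =
    {f \<in> carrier M \<rightarrow> carrier N.
      (\<forall>x\<in>carrier M. \<forall>y\<in>carrier M. f (x \<oplus>\<^bsub>M\<^esub> y) = f x \<oplus>\<^bsub>N\<^esub> f y) \<and>
      (\<forall>a\<in>carrier R. \<forall>x\<in>carrier M. f (a \<odot>\<^bsub>M\<^esub> x) = a \<odot>\<^bsub>N\<^esub> f x)}"

definition left_module_isomorphic ::
  "('a, 'm) ring_scheme \<Rightarrow> ('a, 'b, 'n) module_scheme \<Rightarrow> ('a, 'c, 'o) module_scheme \<Rightarrow> bool"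
  where
  "left_module_isomorphic R M N \<longleftrightarrow>
    left_module R M \<and> left_module R N \<and>
    (\<exists>f \<in> left_module_hom R M N. bij_betw f (carrier M) (carrier N))"

definition direct_sum :: "'i set \<Rightarrow> ('i \<Rightarrow> ('a, 'b, 'n) module_scheme) \<Rightarrow> ('a, 'i \<Rightarrow> 'b) module"
  where
  "direct_sum I M =
    \<lparr>carrier = {u \<in> (\<Pi>\<^sub>E i\<in>I. carrier (M i)). finite {i \<in> I. u i \<noteq> \<zero>\<^bsub>M i\<^esub>}},
     monoid.mult = undefined,
     one = undefined,
     ring.zero = (\<lambda>i\<in>I. \<zero>\<^bsub>M i\<^esub>),
     ring.add = (\<lambda>u v. \<lambda>i\<in>I. u i \<oplus>\<^bsub>M i\<^esub> v i),
     smult = (\<lambda>a u. \<lambda>i\<in>I. a \<odot>\<^bsub>M i\<^esub> u i)\<rparr>"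


section \<open>Tensor product of a bimodule with a left module\<close>

text \<open>In a bimodule, \<open>smult\<close> is the left action \<open>b n\<close> and \<open>rsmult N n a\<close> is the right action \<open>n a\<close>.\<close>

record ('b, 'n, 'a) bimodule = "('b, 'n) module" +
  rsmult :: "'n \<Rightarrow> 'a \<Rightarrow> 'n"

definition tensor_rels ::
  "('a, 'k) ring_scheme \<Rightarrow> ('b, 'n, 'a, 'l) bimodule_scheme \<Rightarrow> ('a, 'm, 'o) module_scheme
    \<Rightarrow> ('n \<times> 'm \<Rightarrow>\<^sub>0 int) set"
  where
  "tensor_rels A N M = generate (free_Abelian_group (carrier N \<times> carrier M))
    ({frag_of (n \<oplus>\<^bsub>N\<^esub> n', m) - frag_of (n, m) - frag_of (n', m) | n n' m.
        n \<in> carrier N \<and> n' \<in> carrier N \<and> m \<in> carrier M} \<union>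
     {frag_of (n, m \<oplus>\<^bsub>M\<^esub> m') - frag_of (n, m) - frag_of (n, m') | n m m'.
        n \<in> carrier N \<and> m \<in> carrier M \<and> m' \<in> carrier M} \<union>
     {frag_of (rsmult N n a, m) - frag_of (n, a \<odot>\<^bsub>M\<^esub> m) | n a m.
        n \<in> carrier N \<and> a \<in> carrier A \<and> m \<in> carrier M})"

text \<open>
  The free abelian group on \<open>N \<times> M\<close> modulo the relations of the tensor product over \<open>A\<close>.
  The left action is induced by the additive extension of \<open>(n, m) \<mapsto> (b n, m)\<close>: this
  extension maps a coset \<open>C\<close> into a single coset, which is recovered by adding the subgroup of relations.
\<close>

definition tensor ::
  "('a, 'k) ring_scheme \<Rightarrow> ('b, 'n, 'a, 'l) bimodule_scheme \<Rightarrow> ('a, 'm, 'o) module_scheme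
    \<Rightarrow> ('b, ('n \<times> 'm \<Rightarrow>\<^sub>0 int) set) module"
  where
  "tensor A N M =
    (let F = free_Abelian_group (carrier N \<times> carrier M);
         T = tensor_rels A N M
     in \<lparr>carrier = carrier (F Mod T),
         monoid.mult = undefined,
         one = undefined,
         ring.zero = \<one>\<^bsub>F Mod T\<^esub>,
         ring.add = (\<lambda>C D. C \<otimes>\<^bsub>F Mod T\<^esub> D),
         smult = (\<lambda>b C. T <#>\<^bsub>F\<^esub> frag_extend (\<lambda>(n, m). frag_of (b \<odot>\<^bsub>N\<^esub> n, m)) ` C)\<rparr>)"


section \<open>Group rings of finite groups\<close>

text \<open>
  The function \<open>a\<close> stands for the formal sum of the \<open>a g \<cdot> g\<close>. No condition of finite support is
  imposed, so this is the group ring only for a finite group \<open>G\<close>.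
\<close>

definition group_ring :: "('r, 'm) ring_scheme \<Rightarrow> ('g, 'n) monoid_scheme \<Rightarrow> ('g \<Rightarrow> 'r) ring"
  where
  "group_ring R G =
    \<lparr>carrier = carrier G \<rightarrow>\<^sub>E carrier R,
     monoid.mult = (\<lambda>a b. \<lambda>g\<in>carrier G. \<Oplus>\<^bsub>R\<^esub>h\<in>carrier G. a h \<otimes>\<^bsub>R\<^esub> b (inv\<^bsub>G\<^esub> h \<otimes>\<^bsub>G\<^esub> g)),
     one = (\<lambda>g\<in>carrier G. if g = \<one>\<^bsub>G\<^esub> then \<one>\<^bsub>R\<^esub> else \<zero>\<^bsub>R\<^esub>),
     ring.zero = (\<lambda>g\<in>carrier G. \<zero>\<^bsub>R\<^esub>),
     ring.add = (\<lambda>a b. \<lambda>g\<in>carrier G. a g \<oplus>\<^bsub>R\<^esub> b g)\<rparr>"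

text \<open>The \<open>R\<close>-linear extension of a group homomorphism \<open>\<phi>\<close> to the group rings.\<close>

definition group_ring_map ::
  "('r, 'm) ring_scheme \<Rightarrow> ('g, 'n) monoid_scheme \<Rightarrow> ('h, 'o) monoid_scheme \<Rightarrow> ('g \<Rightarrow> 'h)
    \<Rightarrow> ('g \<Rightarrow> 'r) \<Rightarrow> ('h \<Rightarrow> 'r)"
  where
  "group_ring_map R G G\<^sub>1 \<phi> a = (\<lambda>h\<in>carrier G\<^sub>1. \<Oplus>\<^bsub>R\<^esub>g\<in>{g \<in> carrier G. \<phi> g = h}. a g)"

definition group_ring_bimodule ::
  "('r, 'm) ring_scheme \<Rightarrow> ('g, 'n) monoid_scheme \<Rightarrow> ('h, 'o) monoid_scheme \<Rightarrow> ('g \<Rightarrow> 'h)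
    \<Rightarrow> ('h \<Rightarrow> 'r, 'h \<Rightarrow> 'r, 'g \<Rightarrow> 'r) bimodule"
  where
  "group_ring_bimodule R G G\<^sub>1 \<phi> =
    \<lparr>carrier = carrier (group_ring R G\<^sub>1),
     monoid.mult = undefined,
     one = undefined,
     ring.zero = \<zero>\<^bsub>group_ring R G\<^sub>1\<^esub>,
     ring.add = (\<lambda>x y. x \<oplus>\<^bsub>group_ring R G\<^sub>1\<^esub> y),
     smult = (\<lambda>b x. b \<otimes>\<^bsub>group_ring R G\<^sub>1\<^esub> x),
     rsmult = (\<lambda>x a. x \<otimes>\<^bsub>group_ring R G\<^sub>1\<^esub> group_ring_map R G G\<^sub>1 \<phi> a)\<rparr>"

definition Ind ::
  "('r, 'm) ring_scheme \<Rightarrow> ('g, 'n) monoid_scheme \<Rightarrow> ('h, 'o) monoid_scheme \<Rightarrow> ('g \<Rightarrow> 'h)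
    \<Rightarrow> ('g \<Rightarrow> 'r, 'v, 'w) module_scheme \<Rightarrow> ('h \<Rightarrow> 'r, (('h \<Rightarrow> 'r) \<times> 'v \<Rightarrow>\<^sub>0 int) set) module"
  where
  "Ind R G G\<^sub>1 \<phi> V = tensor (group_ring R G) (group_ring_bimodule R G G\<^sub>1 \<phi>) V"

definition Res ::
  "('r, 'm) ring_scheme \<Rightarrow> ('g, 'n) monoid_scheme \<Rightarrow> ('h, 'o) monoid_scheme \<Rightarrow> ('g \<Rightarrow> 'h)
    \<Rightarrow> ('h \<Rightarrow> 'r, 'v, 'w) module_scheme \<Rightarrow> ('g \<Rightarrow> 'r, 'v) module"
  where
  "Res R G G\<^sub>1 \<phi> V\<^sub>1 =
    \<lparr>carrier = carrier V\<^sub>1,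
     monoid.mult = undefined,
     one = undefined,
     ring.zero = \<zero>\<^bsub>V\<^sub>1\<^esub>,
     ring.add = (\<lambda>x y. x \<oplus>\<^bsub>V\<^sub>1\<^esub> y),
     smult = (\<lambda>a x. group_ring_map R G G\<^sub>1 \<phi> a \<odot>\<^bsub>V\<^sub>1\<^esub> x)\<rparr>"


section \<open>Pullbacks and double cosets\<close>

definition conj_hom :: "('g, 'n) monoid_scheme \<Rightarrow> 'g \<Rightarrow> ('k \<Rightarrow> 'g) \<Rightarrow> 'k \<Rightarrow> 'g"
  where "conj_hom G x \<alpha> = (\<lambda>k. x \<otimes>\<^bsub>G\<^esub> \<alpha> k \<otimes>\<^bsub>G\<^esub> inv\<^bsub>G\<^esub> x)"

definition pullback ::
  "('k, 'm) monoid_scheme \<Rightarrow> ('h, 'n) monoid_scheme \<Rightarrow> ('k \<Rightarrow> 'g) \<Rightarrow> ('h \<Rightarrow> 'g) \<Rightarrow> ('k \<times> 'h) monoid"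
  where
  "pullback K H \<alpha> \<beta> =
    (K \<times>\<times> H)\<lparr>carrier := {(k, h). k \<in> carrier K \<and> h \<in> carrier H \<and> \<alpha> k = \<beta> h}\<rparr>"

definition double_cosets :: "('g, 'n) monoid_scheme \<Rightarrow> 'g set \<Rightarrow> 'g set \<Rightarrow> 'g set set"
  where "double_cosets G A B = {(A #>\<^bsub>G\<^esub> x) <#>\<^bsub>G\<^esub> B | x. x \<in> carrier G}"

definition double_coset_reps :: "('g, 'n) monoid_scheme \<Rightarrow> 'g set \<Rightarrow> 'g set \<Rightarrow> 'g set \<Rightarrow> bool"
  where
  "double_coset_reps G A B S \<longleftrightarrow>
    S \<subseteq> carrier G \<and> (\<forall>D \<in> double_cosets G A B. \<exists>!x. x \<in> S \<inter> D)"

end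

theory Submission
  imports Defs
begin

text \<open>
  The induced module \<open>Ind\<^sub>\<alpha> V\<close> is additively generated by the elements \<open>g \<otimes> v\<close> with \<open>g \<in> G\<close> and
  \<open>v \<in> V\<close>, and all relations between them follow from additivity in \<open>v\<close> and
  \<open>g \<alpha>(k) \<otimes> v = g \<otimes> k v\<close> (lemmas \<open>Ind_induct\<close> and \<open>Ind_lift\<close>). The coefficients from \<open>R\<close> do not
  enter these relations, because \<open>r \<cdot> g \<otimes> v = g \<otimes> r v\<close>. An element \<open>h \<in> H\<close> acts on the restriction
  to \<open>H\<close> by \<open>g \<otimes> v \<mapsto> \<beta>(h) g \<otimes> v\<close>. Neither the relations nor this action leave the double coset
  \<open>\<beta>(H) g \<alpha>(K)\<close>, so \<open>Res\<^sub>\<beta> Ind\<^sub>\<alpha> V\<close> splits over the double cosets.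

  The summand of a representative \<open>x\<close> consists of the sums of elements \<open>\<beta>(h) x \<alpha>(k) \<otimes> v\<close>, and
  \<open>\<beta>(h) x \<alpha>(k) \<otimes> v = \<beta>(h) x \<otimes> k v\<close> should correspond to \<open>h \<otimes> k v\<close>. The pair \<open>(h, k)\<close> is
  determined by \<open>g = \<beta>(h) x \<alpha>(k)\<close> only up to an element of the pullback \<open>B\<^sub>x\<close>, and changing it by
  such an element does not change \<open>h \<otimes> k v\<close> in the tensor product over \<open>R B\<^sub>x\<close> (lemma
  \<open>decomposes_unique\<close>). This gives a linear projection to each summand. In the other direction,
  \<open>h \<otimes> v \<mapsto> \<beta>(h) x \<otimes> v\<close> is well defined for the same reason, and on generators one sees that the two
  families of maps are inverse to each other (theorem \<open>mackey_formula\<close>).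

  All maps are additive, so identities are checked on generators only: on one-term elements of a group
  ring, on pure tensors, and on the elements \<open>g \<otimes> v\<close> of an induced module.
\<close>


section \<open>Group rings\<close>

locale finite_group_ring = R: cring R + G: group G
  for R :: "('r, 'm) ring_scheme" and G :: "('g, 'n) monoid_scheme" +
  assumes finite_carrier: "finite (carrier G)"

text \<open>The element \<open>r \<cdot> g\<close> of the group ring.\<close>

definition gr_single :: "('r, 'm) ring_scheme \<Rightarrow> ('g, 'n) monoid_scheme \<Rightarrow> 'g \<Rightarrow> 'r \<Rightarrow> 'g \<Rightarrow> 'r"
  where "gr_single R G g r = (\<lambda>x\<in>carrier G. if x = g then r else \<zero>\<^bsub>R\<^esub>)"

context finite_group_ring
begin

abbreviation RG where "RG \<equiv> group_ring R G"

lemma group_ring_apply_closed [simp]: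
  "a \<in> carrier RG \<Longrightarrow> g \<in> carrier G \<Longrightarrow> a g \<in> carrier R"
  by (auto simp: group_ring_def PiE_def Pi_def)

lemma group_ring_add_apply:
  "g \<in> carrier G \<Longrightarrow> (a \<oplus>\<^bsub>RG\<^esub> b) g = a g \<oplus>\<^bsub>R\<^esub> b g"
  by (simp add: group_ring_def)

lemma group_ring_zero_apply: "g \<in> carrier G \<Longrightarrow> \<zero>\<^bsub>RG\<^esub> g = \<zero>\<^bsub>R\<^esub>"
  by (simp add: group_ring_def)

lemma group_ring_mult_apply:
  "g \<in> carrier G \<Longrightarrow>
    (a \<otimes>\<^bsub>RG\<^esub> b) g = (\<Oplus>\<^bsub>R\<^esub>h\<in>carrier G. a h \<otimes>\<^bsub>R\<^esub> b (inv\<^bsub>G\<^esub> h \<otimes>\<^bsub>G\<^esub> g))"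
  by (simp add: group_ring_def)

lemma restrict_in_group_ring [simp]:
  "(\<And>g. g \<in> carrier G \<Longrightarrow> f g \<in> carrier R) \<Longrightarrow> (\<lambda>g\<in>carrier G. f g) \<in> carrier RG"
  by (auto simp: group_ring_def)

lemma group_ring_eqI:
  assumes "a \<in> carrier RG" "b \<in> carrier RG" "\<And>g. g \<in> carrier G \<Longrightarrow> a g = b g"
  shows "a = b"
  using assms by (auto simp: group_ring_def intro: PiE_ext)

lemma single_closed [simp]: "r \<in> carrier R \<Longrightarrow> gr_single R G g r \<in> carrier RG"
  by (auto simp: gr_single_def group_ring_def)

lemma single_apply:
  "x \<in> carrier G \<Longrightarrow> gr_single R G g r x = (if x = g then r else \<zero>\<^bsub>R\<^esub>)"
  by (simp add: gr_single_def)

lemma one_eq_single: "\<one>\<^bsub>RG\<^esub> = gr_single R G \<one>\<^bsub>G\<^esub> \<one>\<^bsub>R\<^esub>"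
  by (simp add: gr_single_def group_ring_def)

lemma single_add:
  "r \<in> carrier R \<Longrightarrow> s \<in> carrier R \<Longrightarrow>
    gr_single R G g (r \<oplus>\<^bsub>R\<^esub> s) = gr_single R G g r \<oplus>\<^bsub>RG\<^esub> gr_single R G g s"
  by (auto simp: gr_single_def group_ring_def)

lemma group_ring_add_closed:
  "a \<in> carrier RG \<Longrightarrow> b \<in> carrier RG \<Longrightarrow> a \<oplus>\<^bsub>RG\<^esub> b \<in> carrier RG"
  by (auto simp: group_ring_def)

lemma group_ring_zero_closed: "\<zero>\<^bsub>RG\<^esub> \<in> carrier RG"
  by (auto simp: group_ring_def)

lemma abelian_group_group_ring: "abelian_group RG"
proof (rule abelian_groupI)
  note [simp] = group_ring_add_closed group_ring_zero_closed group_ring_add_apply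
    group_ring_zero_apply
  show "\<zero>\<^bsub>RG\<^esub> \<in> carrier RG" by simp
  fix a assume a: "a \<in> carrier RG"
  define b where "b = (\<lambda>g\<in>carrier G. \<ominus>\<^bsub>R\<^esub> a g)"
  have b: "b \<in> carrier RG"
    using a by (auto simp: b_def group_ring_def)
  moreover have "b \<oplus>\<^bsub>RG\<^esub> a = \<zero>\<^bsub>RG\<^esub>"
    using a b by (intro group_ring_eqI) (simp_all, simp add: b_def R.l_neg)
  ultimately show "\<exists>b\<in>carrier RG. b \<oplus>\<^bsub>RG\<^esub> a = \<zero>\<^bsub>RG\<^esub>" by blast
  show "\<zero>\<^bsub>RG\<^esub> \<oplus>\<^bsub>RG\<^esub> a = a"
    using a by (intro group_ring_eqI) simp_all
  fix b assume b: "b \<in> carrier RG"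
  with a show "a \<oplus>\<^bsub>RG\<^esub> b \<in> carrier RG" by simp
  from a b show "a \<oplus>\<^bsub>RG\<^esub> b = b \<oplus>\<^bsub>RG\<^esub> a"
    by (intro group_ring_eqI) (simp_all add: R.a_comm)
  fix c assume "c \<in> carrier RG"
  with a b show "a \<oplus>\<^bsub>RG\<^esub> b \<oplus>\<^bsub>RG\<^esub> c = a \<oplus>\<^bsub>RG\<^esub> (b \<oplus>\<^bsub>RG\<^esub> c)"
    by (intro group_ring_eqI) (simp_all add: R.a_assoc)
qed

sublocale A: abelian_group RG by (rule abelian_group_group_ring)

text \<open>As the group is finite, every element of the group ring is a finite sum of elements
  \<open>r \<cdot> g\<close>. All identities that are additive in each argument are therefore checked on these.\<close>

lemma group_ring_induct [consumes 1, case_names zero single add]: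
  assumes a: "a \<in> carrier RG"
    and zero: "P \<zero>\<^bsub>RG\<^esub>"
    and single: "\<And>g r. g \<in> carrier G \<Longrightarrow> r \<in> carrier R \<Longrightarrow> P (gr_single R G g r)"
    and add: "\<And>a b. a \<in> carrier RG \<Longrightarrow> b \<in> carrier RG \<Longrightarrow> P a \<Longrightarrow> P b \<Longrightarrow> P (a \<oplus>\<^bsub>RG\<^esub> b)"
  shows "P a"
proof -
  define c where "c A = (\<lambda>g\<in>carrier G. if g \<in> A then a g else \<zero>\<^bsub>R\<^esub>)" for A
  have c: "c A \<in> carrier RG" for A
    using a by (simp add: c_def)
  have "P (c A)" if "finite A" "A \<subseteq> carrier G" for A
    using that
  proof (induction A rule: finite_induct)
    case empty
    have "c {} = \<zero>\<^bsub>RG\<^esub>" by (simp add: c_def group_ring_def)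
    then show ?case using zero by simp
  next
    case (insert g A)
    have "c (insert g A) = gr_single R G g (a g) \<oplus>\<^bsub>RG\<^esub> c A"
    proof (rule group_ring_eqI)
      show "c (insert g A) x = (gr_single R G g (a g) \<oplus>\<^bsub>RG\<^esub> c A) x" if "x \<in> carrier G" for x
        using a insert that by (auto simp: c_def group_ring_add_apply gr_single_def)
    qed (use a insert c in auto)
    then show ?case using a insert c by (auto intro!: add single)
  qed
  moreover have "c (carrier G) = a"
    using a c by (auto simp: c_def intro!: group_ring_eqI)
  ultimately show ?thesis using finite_carrier by auto
qed

lemma group_ring_mult_closed [simp]:
  "a \<in> carrier RG \<Longrightarrow> b \<in> carrier RG \<Longrightarrow> a \<otimes>\<^bsub>RG\<^esub> b \<in> carrier RG"
  by (subst group_ring_def) (auto intro!: restrict_in_group_ring R.finsum_closed)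

lemma group_ring_l_distr:
  assumes "a \<in> carrier RG" "b \<in> carrier RG" "c \<in> carrier RG"
  shows "(a \<oplus>\<^bsub>RG\<^esub> b) \<otimes>\<^bsub>RG\<^esub> c = a \<otimes>\<^bsub>RG\<^esub> c \<oplus>\<^bsub>RG\<^esub> b \<otimes>\<^bsub>RG\<^esub> c"
proof (rule group_ring_eqI)
  fix g assume "g \<in> carrier G"
  with assms show "((a \<oplus>\<^bsub>RG\<^esub> b) \<otimes>\<^bsub>RG\<^esub> c) g = (a \<otimes>\<^bsub>RG\<^esub> c \<oplus>\<^bsub>RG\<^esub> b \<otimes>\<^bsub>RG\<^esub> c) g"
    by (simp add: group_ring_mult_apply group_ring_add_apply Pi_def R.l_distr
        flip: R.finsum_addf cong: R.finsum_cong)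
qed (use assms in simp_all)

lemma group_ring_r_distr:
  assumes "a \<in> carrier RG" "b \<in> carrier RG" "c \<in> carrier RG"
  shows "c \<otimes>\<^bsub>RG\<^esub> (a \<oplus>\<^bsub>RG\<^esub> b) = c \<otimes>\<^bsub>RG\<^esub> a \<oplus>\<^bsub>RG\<^esub> c \<otimes>\<^bsub>RG\<^esub> b"
proof (rule group_ring_eqI)
  fix g assume "g \<in> carrier G"
  with assms show "(c \<otimes>\<^bsub>RG\<^esub> (a \<oplus>\<^bsub>RG\<^esub> b)) g = (c \<otimes>\<^bsub>RG\<^esub> a \<oplus>\<^bsub>RG\<^esub> c \<otimes>\<^bsub>RG\<^esub> b) g"
    by (simp add: group_ring_mult_apply group_ring_add_apply Pi_def R.r_distr
        flip: R.finsum_addf cong: R.finsum_cong)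
qed (use assms in simp_all)

lemma group_ring_zero_mult [simp]:
  assumes "a \<in> carrier RG" shows "\<zero>\<^bsub>RG\<^esub> \<otimes>\<^bsub>RG\<^esub> a = \<zero>\<^bsub>RG\<^esub>" "a \<otimes>\<^bsub>RG\<^esub> \<zero>\<^bsub>RG\<^esub> = \<zero>\<^bsub>RG\<^esub>"
proof -
  show "\<zero>\<^bsub>RG\<^esub> \<otimes>\<^bsub>RG\<^esub> a = \<zero>\<^bsub>RG\<^esub>"
    using group_ring_l_distr[of "\<zero>\<^bsub>RG\<^esub>" "\<zero>\<^bsub>RG\<^esub>" a] assms A.add.l_cancel_one' by auto
  show "a \<otimes>\<^bsub>RG\<^esub> \<zero>\<^bsub>RG\<^esub> = \<zero>\<^bsub>RG\<^esub>"
    using group_ring_r_distr[of "\<zero>\<^bsub>RG\<^esub>" "\<zero>\<^bsub>RG\<^esub>" a] assms A.add.l_cancel_one' by auto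
qed

lemma single_mult:
  assumes g: "g \<in> carrier G" and h: "h \<in> carrier G" and r: "r \<in> carrier R" and s: "s \<in> carrier R"
  shows "gr_single R G g r \<otimes>\<^bsub>RG\<^esub> gr_single R G h s = gr_single R G (g \<otimes>\<^bsub>G\<^esub> h) (r \<otimes>\<^bsub>R\<^esub> s)"
proof (rule group_ring_eqI)
  fix x assume x: "x \<in> carrier G"
  have iff: "inv\<^bsub>G\<^esub> g \<otimes>\<^bsub>G\<^esub> x = h \<longleftrightarrow> x = g \<otimes>\<^bsub>G\<^esub> h"
    using g h x G.inv_solve_left' by (metis G.inv_solve_left)
  have "(gr_single R G g r \<otimes>\<^bsub>RG\<^esub> gr_single R G h s) x =
      (\<Oplus>\<^bsub>R\<^esub>y\<in>carrier G. if g = y then r \<otimes>\<^bsub>R\<^esub> gr_single R G h s (inv\<^bsub>G\<^esub> y \<otimes>\<^bsub>G\<^esub> x) else \<zero>\<^bsub>R\<^esub>)"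
    using assms x by (auto simp: group_ring_mult_apply single_apply intro!: R.finsum_cong')
  also have "\<dots> = r \<otimes>\<^bsub>R\<^esub> gr_single R G h s (inv\<^bsub>G\<^esub> g \<otimes>\<^bsub>G\<^esub> x)"
    using assms x finite_carrier
    by (intro R.finsum_singleton) (auto simp: group_ring_apply_closed)
  finally show "(gr_single R G g r \<otimes>\<^bsub>RG\<^esub> gr_single R G h s) x = gr_single R G (g \<otimes>\<^bsub>G\<^esub> h) (r \<otimes>\<^bsub>R\<^esub> s) x"
    using assms x iff by (simp add: single_apply)
qed (use assms in simp_all)

text \<open>Every ring law to be shown is additive in each of its variables, so it reduces to elements with one
term, where it is the corresponding law of \<open>G\<close> together with that of \<open>R\<close>. In this way no multiple
convolution sum has to be rearranged.\<close>

lemma ring_group_ring: "ring RG"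
proof (rule ringI)
  have assoc: "a \<otimes>\<^bsub>RG\<^esub> b \<otimes>\<^bsub>RG\<^esub> c = a \<otimes>\<^bsub>RG\<^esub> (b \<otimes>\<^bsub>RG\<^esub> c)"
    if a: "a \<in> carrier RG" and b: "b \<in> carrier RG" and c: "c \<in> carrier RG" for a b c
    using a
  proof (induction a rule: group_ring_induct)
    case (single g r)
    from b show ?case
    proof (induction b rule: group_ring_induct)
      case (single h s)
      from c show ?case
      proof (induction c rule: group_ring_induct)
        case (single k t)
        with \<open>g \<in> _\<close> \<open>h \<in> _\<close> \<open>r \<in> _\<close> \<open>s \<in> _\<close> show ?case
          by (simp add: single_mult G.m_assoc R.m_assoc)
      qed (use single \<open>r \<in> _\<close> in \<open>simp_all add: group_ring_r_distr\<close>)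
    qed (use single c in \<open>simp_all add: group_ring_l_distr group_ring_r_distr\<close>)
  qed (use b c in \<open>simp_all add: group_ring_l_distr\<close>)
  have l: "\<one>\<^bsub>RG\<^esub> \<otimes>\<^bsub>RG\<^esub> a = a" if "a \<in> carrier RG" for a
    using that by (induction a rule: group_ring_induct)
      (simp_all add: one_eq_single single_mult group_ring_r_distr)
  have r: "a \<otimes>\<^bsub>RG\<^esub> \<one>\<^bsub>RG\<^esub> = a" if "a \<in> carrier RG" for a
    using that by (induction a rule: group_ring_induct)
      (simp_all add: one_eq_single single_mult group_ring_l_distr)
  show "monoid RG"
    by (intro monoidI) (simp_all add: assoc l r, simp add: one_eq_single)
qed (simp_all add: abelian_group_group_ring group_ring_l_distr group_ring_r_distr)

sublocale A: ring RG by (rule ring_group_ring)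

end

locale finite_group_ring_hom =
  A: finite_group_ring R G + B: finite_group_ring R G\<^sub>1 + \<phi>: group_hom G G\<^sub>1 \<phi>
  for R :: "('r, 'm) ring_scheme" and G :: "('g, 'n) monoid_scheme"
    and G\<^sub>1 :: "('h, 'o) monoid_scheme" and \<phi>
begin

abbreviation "\<phi>R \<equiv> group_ring_map R G G\<^sub>1 \<phi>"

lemma group_ring_map_closed [simp]: "a \<in> carrier A.RG \<Longrightarrow> \<phi>R a \<in> carrier B.RG"
  by (auto simp: group_ring_map_def intro!: B.restrict_in_group_ring A.R.finsum_closed)

lemma group_ring_map_add:
  "a \<in> carrier A.RG \<Longrightarrow> b \<in> carrier A.RG \<Longrightarrow> \<phi>R (a \<oplus>\<^bsub>A.RG\<^esub> b) = \<phi>R a \<oplus>\<^bsub>B.RG\<^esub> \<phi>R b"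
  by (intro B.group_ring_eqI)
    (simp_all add: group_ring_map_def A.group_ring_add_apply B.group_ring_add_apply Pi_def
        flip: A.R.finsum_addf cong: A.R.finsum_cong)

lemma group_ring_map_zero [simp]: "\<phi>R \<zero>\<^bsub>A.RG\<^esub> = \<zero>\<^bsub>B.RG\<^esub>"
  using group_ring_map_add[of "\<zero>\<^bsub>A.RG\<^esub>" "\<zero>\<^bsub>A.RG\<^esub>"] B.A.add.l_cancel_one'[of "\<phi>R \<zero>\<^bsub>A.RG\<^esub>"] by simp

lemma group_ring_map_single:
  assumes "g \<in> carrier G" "r \<in> carrier R"
  shows "\<phi>R (gr_single R G g r) = gr_single R G\<^sub>1 (\<phi> g) r"
proof (rule B.group_ring_eqI)
  fix h assume h: "h \<in> carrier G\<^sub>1"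
  let ?A = "{x \<in> carrier G. \<phi> x = h}"
  have eq: "\<phi>R (gr_single R G g r) h = (\<Oplus>\<^bsub>R\<^esub>x\<in>?A. if g = x then r else \<zero>\<^bsub>R\<^esub>)"
    using assms h by (auto simp: group_ring_map_def gr_single_def intro!: A.R.finsum_cong')
  show "\<phi>R (gr_single R G g r) h = gr_single R G\<^sub>1 (\<phi> g) r h"
  proof (cases "\<phi> g = h")
    case True
    then show ?thesis
      using eq assms h A.finite_carrier A.R.finsum_singleton[of g ?A "\<lambda>_. r"]
      by (simp add: gr_single_def)
  next
    case False
    then have "\<phi>R (gr_single R G g r) h = (\<Oplus>\<^bsub>R\<^esub>x\<in>?A. \<zero>\<^bsub>R\<^esub>)"
      unfolding eq using assms by (intro A.R.finsum_cong') auto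
    with False h show ?thesis by (simp add: gr_single_def)
  qed
qed (use assms in simp_all)

text \<open>Both sides are additive in \<open>a\<close> and in \<open>b\<close>, and on \<open>r \<cdot> g\<close> and \<open>s \<cdot> h\<close> the claim is
\<open>\<phi> (g h) = \<phi> g \<phi> h\<close>.\<close>

lemma group_ring_map_mult:
  assumes a: "a \<in> carrier A.RG" and b: "b \<in> carrier A.RG"
  shows "\<phi>R (a \<otimes>\<^bsub>A.RG\<^esub> b) = \<phi>R a \<otimes>\<^bsub>B.RG\<^esub> \<phi>R b"
  using a
proof (induction a rule: A.group_ring_induct)
  case (single g r)
  from b show ?case
  proof (induction b rule: A.group_ring_induct)
    case (single h s)
    with \<open>g \<in> _\<close> \<open>r \<in> _\<close> show ?case
      by (simp add: A.single_mult B.single_mult group_ring_map_single)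
  qed (use single in \<open>simp_all add: A.group_ring_r_distr B.group_ring_r_distr group_ring_map_add\<close>)
qed (use b in \<open>simp_all add: A.group_ring_l_distr B.group_ring_l_distr group_ring_map_add\<close>)

lemma group_ring_map_one: "\<phi>R \<one>\<^bsub>A.RG\<^esub> = \<one>\<^bsub>B.RG\<^esub>"
  by (simp add: A.one_eq_single B.one_eq_single group_ring_map_single)

end


section \<open>Left modules and additive maps\<close>

context left_module
begin

lemma smult_l_null [simp]:
  assumes "x \<in> carrier M" shows "\<zero>\<^bsub>R\<^esub> \<odot>\<^bsub>M\<^esub> x = \<zero>\<^bsub>M\<^esub>"
proof -
  have "\<zero>\<^bsub>R\<^esub> \<odot>\<^bsub>M\<^esub> x = \<zero>\<^bsub>R\<^esub> \<odot>\<^bsub>M\<^esub> x \<oplus>\<^bsub>M\<^esub> \<zero>\<^bsub>R\<^esub> \<odot>\<^bsub>M\<^esub> x"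
    using smult_l_distr[of "\<zero>\<^bsub>R\<^esub>" "\<zero>\<^bsub>R\<^esub>" x] assms by simp
  then show ?thesis
    using M.add.l_cancel_one'[of "\<zero>\<^bsub>R\<^esub> \<odot>\<^bsub>M\<^esub> x" "\<zero>\<^bsub>R\<^esub> \<odot>\<^bsub>M\<^esub> x"] smult_closed assms by simp
qed

lemma smult_r_null [simp]:
  assumes "a \<in> carrier R" shows "a \<odot>\<^bsub>M\<^esub> \<zero>\<^bsub>M\<^esub> = \<zero>\<^bsub>M\<^esub>"
proof -
  have "a \<odot>\<^bsub>M\<^esub> \<zero>\<^bsub>M\<^esub> = a \<odot>\<^bsub>M\<^esub> \<zero>\<^bsub>M\<^esub> \<oplus>\<^bsub>M\<^esub> a \<odot>\<^bsub>M\<^esub> \<zero>\<^bsub>M\<^esub>"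
    using smult_r_distr[of a "\<zero>\<^bsub>M\<^esub>" "\<zero>\<^bsub>M\<^esub>"] assms by simp
  then show ?thesis
    using M.add.l_cancel_one'[of "a \<odot>\<^bsub>M\<^esub> \<zero>\<^bsub>M\<^esub>" "a \<odot>\<^bsub>M\<^esub> \<zero>\<^bsub>M\<^esub>"] smult_closed assms by simp
qed

end

abbreviation additive_hom ::
  "('a, 'm) ring_scheme \<Rightarrow> ('b, 'n) ring_scheme \<Rightarrow> ('a \<Rightarrow> 'b) set"
  where "additive_hom M N \<equiv> hom (add_monoid M) (add_monoid N)"

lemma additive_hom_closed: "f \<in> additive_hom M N \<Longrightarrow> x \<in> carrier M \<Longrightarrow> f x \<in> carrier N"
  by (auto simp: hom_def)

lemma additive_hom_add:
  "f \<in> additive_hom M N \<Longrightarrow> x \<in> carrier M \<Longrightarrow> y \<in> carrier M \<Longrightarrow> f (x \<oplus>\<^bsub>M\<^esub> y) = f x \<oplus>\<^bsub>N\<^esub> f y"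
  by (auto simp: hom_def)

lemma additive_hom_zero:
  assumes "abelian_group M" "abelian_group N" "f \<in> additive_hom M N"
  shows "f \<zero>\<^bsub>M\<^esub> = \<zero>\<^bsub>N\<^esub>"
  using hom_one[OF assms(3)] assms(1,2)[THEN abelian_group.a_group] by simp

lemma additive_hom_finsum:
  assumes M: "abelian_group M" and N: "abelian_group N" and f: "f \<in> additive_hom M N"
    and I: "finite I" and u: "\<And>i. i \<in> I \<Longrightarrow> u i \<in> carrier M"
  shows "f (\<Oplus>\<^bsub>M\<^esub>i\<in>I. u i) = (\<Oplus>\<^bsub>N\<^esub>i\<in>I. f (u i))"
proof -
  interpret M: abelian_group M by fact
  interpret N: abelian_group N by fact
  from I u show ?thesis
  proof (induction I rule: finite_induct)
    case empty
    then show ?case by (simp add: additive_hom_zero[OF M N f])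
  next
    case (insert i I)
    then show ?case
      by (simp add: Pi_def additive_hom_add[OF f] additive_hom_closed[OF f] M.finsum_closed)
  qed
qed


section \<open>Tensor products\<close>

text \<open>The assumption \<open>smult_rsmult\<close> says that the left action of \<open>B\<close> and the right action of \<open>A\<close> on \<open>N\<close>
commute; it is the reason why the left action respects the balancing relations.\<close>

locale bimodule_tensor = N: left_module B N + M: left_module A M
  for A :: "('a, 'k) ring_scheme" and B :: "('b, 'l) ring_scheme"
    and N :: "('b, 'n, 'a, 'p) bimodule_scheme" and M :: "('a, 'm, 'q) module_scheme" +
  assumes rsmult_closed:
      "n \<in> carrier N \<Longrightarrow> a \<in> carrier A \<Longrightarrow> rsmult N n a \<in> carrier N"
    and smult_rsmult:
      "b \<in> carrier B \<Longrightarrow> n \<in> carrier N \<Longrightarrow> a \<in> carrier A \<Longrightarrow>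
        b \<odot>\<^bsub>N\<^esub> rsmult N n a = rsmult N (b \<odot>\<^bsub>N\<^esub> n) a"

definition pure_tensor ::
  "('a, 'k) ring_scheme \<Rightarrow> ('b, 'n, 'a, 'l) bimodule_scheme \<Rightarrow> ('a, 'm, 'o) module_scheme
    \<Rightarrow> 'n \<Rightarrow> 'm \<Rightarrow> ('n \<times> 'm \<Rightarrow>\<^sub>0 int) set"
  where "pure_tensor A N M n m =
    tensor_rels A N M #>\<^bsub>free_Abelian_group (carrier N \<times> carrier M)\<^esub> frag_of (n, m)"

context bimodule_tensor
begin

abbreviation "F \<equiv> free_Abelian_group (carrier N \<times> carrier M)"
abbreviation "T \<equiv> tensor_rels A N M"
abbreviation "Q \<equiv> tensor A N M"
abbreviation pure (infixl \<open>\<boxtimes>\<close> 70) where "n \<boxtimes> m \<equiv> pure_tensor A N M n m"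

text \<open>The relators that generate the subgroup of relations, as a set of their own: a homomorphism out of the
tensor product, or the left action, has to be checked only on these.\<close>

definition gens where
  "gens =
    {frag_of (n \<oplus>\<^bsub>N\<^esub> n', m) - frag_of (n, m) - frag_of (n', m) | n n' m.
        n \<in> carrier N \<and> n' \<in> carrier N \<and> m \<in> carrier M} \<union>
     {frag_of (n, m \<oplus>\<^bsub>M\<^esub> m') - frag_of (n, m) - frag_of (n, m') | n m m'.
        n \<in> carrier N \<and> m \<in> carrier M \<and> m' \<in> carrier M} \<union>
     {frag_of (rsmult N n a, m) - frag_of (n, a \<odot>\<^bsub>M\<^esub> m) | n a m.
        n \<in> carrier N \<and> a \<in> carrier A \<and> m \<in> carrier M}"

lemma rels_eq: "T = generate F gens"
  by (simp add: tensor_rels_def gens_def)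

sublocale F: comm_group F by (rule abelian_free_Abelian_group)

lemma frag_of_closed: "n \<in> carrier N \<Longrightarrow> m \<in> carrier M \<Longrightarrow> frag_of (n, m) \<in> carrier F"
  by simp

lemma F_diff_closed: "x \<in> carrier F \<Longrightarrow> y \<in> carrier F \<Longrightarrow> x - y \<in> carrier F"
  using keys_diff[of x y] by auto

lemma F_add_closed: "x \<in> carrier F \<Longrightarrow> y \<in> carrier F \<Longrightarrow> x + y \<in> carrier F"
  using F.m_closed[of x y] by simp

lemma gens_subset: "gens \<subseteq> carrier F"
  unfolding gens_def
  by (auto simp del: carrier_free_Abelian_group_iff
      intro!: F_diff_closed frag_of_closed rsmult_closed M.smult_closed)

lemma subgroup_rels: "subgroup T F"
  unfolding rels_eq by (rule F.generate_is_subgroup[OF gens_subset])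

sublocale T: normal T F
  by (rule F.subgroup_imp_normal[OF subgroup_rels])

lemma gens_in_rels: "x \<in> gens \<Longrightarrow> x \<in> T"
  unfolding rels_eq by (rule generate.incl)

lemma carrier_tensor: "carrier Q = (\<lambda>x. T #>\<^bsub>F\<^esub> x) ` carrier F"
  by (simp add: tensor_def Let_def carrier_FactGroup)

lemma coset_add:
  "x \<in> carrier F \<Longrightarrow> y \<in> carrier F \<Longrightarrow> (T #>\<^bsub>F\<^esub> x) \<oplus>\<^bsub>Q\<^esub> (T #>\<^bsub>F\<^esub> y) = T #>\<^bsub>F\<^esub> (x + y)"
  using T.rcos_sum[of x y] by (simp add: tensor_def Let_def)

lemma coset_zero: "T #>\<^bsub>F\<^esub> 0 = \<zero>\<^bsub>Q\<^esub>"
  using F.coset_mult_one[OF T.subset] by (simp add: tensor_def Let_def)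

lemma coset_eqI:
  assumes x: "x \<in> carrier F" and y: "y \<in> carrier F" and d: "x - y \<in> T"
  shows "T #>\<^bsub>F\<^esub> x = T #>\<^bsub>F\<^esub> y"
proof (rule F.repr_independence[OF _ y subgroup_rels, symmetric])
  show "x \<in> T #>\<^bsub>F\<^esub> y"
    using d by (auto simp: r_coset_def intro!: bexI[of _ "x - y"])
qed

lemma abelian_group_tensor: "abelian_group Q"
proof -
  interpret FT: comm_group "F Mod T"
    by (rule F.abelian_FactGroup[OF subgroup_rels])
  have [simp]: "carrier Q = carrier (F Mod T)" "(\<oplus>\<^bsub>Q\<^esub>) = (\<otimes>\<^bsub>F Mod T\<^esub>)" "\<zero>\<^bsub>Q\<^esub> = \<one>\<^bsub>F Mod T\<^esub>"
    by (simp_all add: tensor_def Let_def del: mult_FactGroup one_FactGroup)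
  show ?thesis
  proof (rule abelian_groupI)
    fix x assume "x \<in> carrier Q"
    then show "\<exists>y\<in>carrier Q. y \<oplus>\<^bsub>Q\<^esub> x = \<zero>\<^bsub>Q\<^esub>"
      by (intro bexI[of _ "inv\<^bsub>F Mod T\<^esub> x"])
        (simp_all del: mult_FactGroup one_FactGroup)
  qed (simp_all del: mult_FactGroup one_FactGroup add: FT.m_ac)
qed

sublocale Q: abelian_group Q by (rule abelian_group_tensor)

lemma pure_closed [simp]: "n \<in> carrier N \<Longrightarrow> m \<in> carrier M \<Longrightarrow> n \<boxtimes> m \<in> carrier Q"
  unfolding carrier_tensor pure_tensor_def by (intro imageI frag_of_closed)

lemma pure_add_left:
  assumes "n \<in> carrier N" "n' \<in> carrier N" "m \<in> carrier M"
  shows "(n \<oplus>\<^bsub>N\<^esub> n') \<boxtimes> m = n \<boxtimes> m \<oplus>\<^bsub>Q\<^esub> n' \<boxtimes> m"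
proof -
  have "frag_of (n \<oplus>\<^bsub>N\<^esub> n', m) - (frag_of (n, m) + frag_of (n', m)) \<in> T"
    unfolding diff_diff_eq[symmetric] by (rule gens_in_rels) (use assms in \<open>auto simp: gens_def\<close>)
  from coset_eqI[OF _ _ this] show ?thesis
    unfolding pure_tensor_def using assms
    by (simp del: carrier_free_Abelian_group_iff add: coset_add frag_of_closed F_add_closed)
qed

lemma pure_add_right:
  assumes "n \<in> carrier N" "m \<in> carrier M" "m' \<in> carrier M"
  shows "n \<boxtimes> (m \<oplus>\<^bsub>M\<^esub> m') = n \<boxtimes> m \<oplus>\<^bsub>Q\<^esub> n \<boxtimes> m'"
proof -
  have "frag_of (n, m \<oplus>\<^bsub>M\<^esub> m') - (frag_of (n, m) + frag_of (n, m')) \<in> T"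
    unfolding diff_diff_eq[symmetric] by (rule gens_in_rels) (use assms in \<open>auto simp: gens_def\<close>)
  from coset_eqI[OF _ _ this] show ?thesis
    unfolding pure_tensor_def using assms
    by (simp del: carrier_free_Abelian_group_iff add: coset_add frag_of_closed F_add_closed)
qed

lemma pure_balanced:
  assumes "n \<in> carrier N" "a \<in> carrier A" "m \<in> carrier M"
  shows "rsmult N n a \<boxtimes> m = n \<boxtimes> (a \<odot>\<^bsub>M\<^esub> m)"
proof -
  have "frag_of (rsmult N n a, m) - frag_of (n, a \<odot>\<^bsub>M\<^esub> m) \<in> T"
    by (rule gens_in_rels) (use assms in \<open>auto simp: gens_def\<close>)
  from coset_eqI[OF _ _ this] show ?thesis
    unfolding pure_tensor_def using assms
    by (simp del: carrier_free_Abelian_group_iff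
        add: frag_of_closed rsmult_closed M.smult_closed)
qed

lemma pure_zero_left: "m \<in> carrier M \<Longrightarrow> \<zero>\<^bsub>N\<^esub> \<boxtimes> m = \<zero>\<^bsub>Q\<^esub>"
  using pure_add_left[of "\<zero>\<^bsub>N\<^esub>" "\<zero>\<^bsub>N\<^esub>" m] Q.add.l_cancel_one' by auto

text \<open>Since \<open>- (n \<otimes> m) = (- n) \<otimes> m\<close>, finite sums of pure tensors already form a subgroup, and differences
need no induction step of their own.\<close>

lemma tensor_induct [consumes 1, case_names zero pure add]:
  assumes t: "t \<in> carrier Q"
    and zero: "P \<zero>\<^bsub>Q\<^esub>"
    and pure: "\<And>n m. n \<in> carrier N \<Longrightarrow> m \<in> carrier M \<Longrightarrow> P (n \<boxtimes> m)"
    and add: "\<And>s t. s \<in> carrier Q \<Longrightarrow> t \<in> carrier Q \<Longrightarrow> P s \<Longrightarrow> P t \<Longrightarrow> P (s \<oplus>\<^bsub>Q\<^esub> t)"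
  shows "P t"
proof -
  have *: "P (T #>\<^bsub>F\<^esub> x) \<and> P (T #>\<^bsub>F\<^esub> (- x))" if "Poly_Mapping.keys x \<subseteq> carrier N \<times> carrier M" for x
    using that
  proof (rule free_Abelian_group_induct)
    show "P (T #>\<^bsub>F\<^esub> 0) \<and> P (T #>\<^bsub>F\<^esub> (- 0))"
      using zero by (simp add: coset_zero)
  next
    fix p assume "p \<in> carrier N \<times> carrier M"
    then obtain n m where p: "p = (n, m)" "n \<in> carrier N" "m \<in> carrier M" by auto
    have "(T #>\<^bsub>F\<^esub> (- frag_of p)) \<oplus>\<^bsub>Q\<^esub> n \<boxtimes> m = \<zero>\<^bsub>Q\<^esub>"
      unfolding pure_tensor_def using p by (simp add: coset_add keys_minus coset_zero)
    moreover have "(\<ominus>\<^bsub>N\<^esub> n) \<boxtimes> m \<oplus>\<^bsub>Q\<^esub> n \<boxtimes> m = \<zero>\<^bsub>Q\<^esub>"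
      using p by (simp add: pure_add_left[symmetric] N.M.l_neg pure_zero_left)
    moreover have "(T #>\<^bsub>F\<^esub> (- frag_of p)) \<in> carrier Q"
      using p by (auto simp: carrier_tensor keys_minus)
    ultimately have "T #>\<^bsub>F\<^esub> (- frag_of p) = (\<ominus>\<^bsub>N\<^esub> n) \<boxtimes> m"
      using p Q.add.inv_unique'[of "n \<boxtimes> m"] by (metis N.M.a_inv_closed Q.minus_equality pure_closed)
    then show "P (T #>\<^bsub>F\<^esub> frag_of p) \<and> P (T #>\<^bsub>F\<^esub> (- frag_of p))"
      using p pure[of n m] pure[of "\<ominus>\<^bsub>N\<^esub> n" m] by (simp add: pure_tensor_def)
  next
    fix x y
    assume k: "Poly_Mapping.keys x \<subseteq> carrier N \<times> carrier M" "Poly_Mapping.keys y \<subseteq> carrier N \<times> carrier M"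
      and IH: "P (T #>\<^bsub>F\<^esub> x) \<and> P (T #>\<^bsub>F\<^esub> - x)" "P (T #>\<^bsub>F\<^esub> y) \<and> P (T #>\<^bsub>F\<^esub> - y)"
    have c: "(T #>\<^bsub>F\<^esub> z) \<in> carrier Q" if "Poly_Mapping.keys z \<subseteq> carrier N \<times> carrier M" for z
      using that by (auto simp: carrier_tensor)
    have "T #>\<^bsub>F\<^esub> (x - y) = (T #>\<^bsub>F\<^esub> x) \<oplus>\<^bsub>Q\<^esub> (T #>\<^bsub>F\<^esub> (- y))"
      "T #>\<^bsub>F\<^esub> (- (x - y)) = (T #>\<^bsub>F\<^esub> y) \<oplus>\<^bsub>Q\<^esub> (T #>\<^bsub>F\<^esub> (- x))"
      using k by (simp_all add: coset_add keys_minus)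
    then show "P (T #>\<^bsub>F\<^esub> (x - y)) \<and> P (T #>\<^bsub>F\<^esub> (- (x - y)))"
      using IH k by (auto intro!: add c simp: keys_minus)
  qed
  from t show ?thesis using * by (auto simp: carrier_tensor)
qed

text \<open>The universal property. The homomorphism that \<open>f\<close> induces on the free abelian group kills each relator,
because \<open>f\<close> is additive in both arguments and balanced, and so it factors through the quotient.\<close>

lemma tensor_lift:
  assumes P: "abelian_group P"
    and f: "\<And>n m. n \<in> carrier N \<Longrightarrow> m \<in> carrier M \<Longrightarrow> f n m \<in> carrier P"
    and f_add_left: "\<And>n n' m. n \<in> carrier N \<Longrightarrow> n' \<in> carrier N \<Longrightarrow> m \<in> carrier M \<Longrightarrow>
      f (n \<oplus>\<^bsub>N\<^esub> n') m = f n m \<oplus>\<^bsub>P\<^esub> f n' m"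
    and f_add_right: "\<And>n m m'. n \<in> carrier N \<Longrightarrow> m \<in> carrier M \<Longrightarrow> m' \<in> carrier M \<Longrightarrow>
      f n (m \<oplus>\<^bsub>M\<^esub> m') = f n m \<oplus>\<^bsub>P\<^esub> f n m'"
    and f_balanced: "\<And>n a m. n \<in> carrier N \<Longrightarrow> a \<in> carrier A \<Longrightarrow> m \<in> carrier M \<Longrightarrow>
      f (rsmult N n a) m = f n (a \<odot>\<^bsub>M\<^esub> m)"
  obtains h where "h \<in> additive_hom Q P"
    "\<And>n m. n \<in> carrier N \<Longrightarrow> m \<in> carrier M \<Longrightarrow> h (n \<boxtimes> m) = f n m"
proof -
  interpret P: abelian_group P by fact
  have "(\<lambda>(n, m). f n m) ` (carrier N \<times> carrier M) \<subseteq> carrier (add_monoid P)"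
    using f by auto
  then obtain h where h: "h \<in> hom F (add_monoid P)"
    and "\<And>p. p \<in> carrier N \<times> carrier M \<Longrightarrow> h (frag_of p) = (\<lambda>(n, m). f n m) p"
    by (rule comm_group.free_Abelian_group_universal[OF P.a_comm_group]) blast
  then have hf: "h (frag_of (n, m)) = f n m" if "n \<in> carrier N" "m \<in> carrier M" for n m
    using that by auto
  interpret h: group_hom F "add_monoid P" h
    by unfold_locales (rule h)
  have h_diff: "h (x - y) = h x \<ominus>\<^bsub>P\<^esub> h y" if "x \<in> carrier F" "y \<in> carrier F" for x y
  proof -
    have "h (x - y) = h (x \<otimes>\<^bsub>F\<^esub> inv\<^bsub>F\<^esub> y)"
      using that by simp
    also have "\<dots> = h x \<oplus>\<^bsub>P\<^esub> h (inv\<^bsub>F\<^esub> y)"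
      using that h.hom_mult[of x "inv\<^bsub>F\<^esub> y"] F.inv_closed by (metis monoid.simps(1))
    also have "h (inv\<^bsub>F\<^esub> y) = \<ominus>\<^bsub>P\<^esub> h y"
      using that h.hom_inv[of y] by (simp add: a_inv_def)
    finally show ?thesis by (simp add: a_minus_def)
  qed
  have "gens \<subseteq> kernel F (add_monoid P) h"
  proof
    fix x assume x: "x \<in> gens"
    have "h x = \<zero>\<^bsub>P\<^esub>"
      using x unfolding gens_def
      by (auto simp del: carrier_free_Abelian_group_iff
          simp: h_diff hf f F_diff_closed frag_of_closed rsmult_closed M.smult_closed
            f_add_left f_add_right f_balanced a_minus_def P.r_neg P.a_assoc P.minus_add
            P.add.m_comm P.r_neg1 P.r_neg2 P.add.inv_solve_left')
    with x gens_subset show "x \<in> kernel F (add_monoid P) h"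
      unfolding kernel_def by (simp del: carrier_free_Abelian_group_iff add: subsetD)
  qed
  then have "T \<subseteq> kernel F (add_monoid P) h"
    unfolding rels_eq by (rule F.generate_subgroup_incl[OF _ h.subgroup_kernel])
  then obtain g where g: "g \<in> hom (F Mod T) (add_monoid P)"
    "\<And>x. x \<in> carrier F \<Longrightarrow> g (T #>\<^bsub>F\<^esub> x) = h x"
    using h.FactGroup_universal_kernel[OF T.normal_axioms] by blast
  show thesis
  proof (rule that)
    show "g \<in> additive_hom Q P"
      using g(1) by (simp add: hom_def tensor_def Let_def)
    show "g (n \<boxtimes> m) = f n m" if "n \<in> carrier N" "m \<in> carrier M" for n m
      using that g(2) hf by (simp add: pure_tensor_def)
  qed
qed

definition ext where "ext b = frag_extend (\<lambda>(n, m). frag_of (b \<odot>\<^bsub>N\<^esub> n, m))"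

lemma ext_simps [simp]:
  "ext b 0 = 0" "ext b (frag_of (n, m)) = frag_of (b \<odot>\<^bsub>N\<^esub> n, m)"
  "ext b (x + y) = ext b x + ext b y" "ext b (x - y) = ext b x - ext b y" "ext b (- x) = - ext b x"
  by (simp_all add: ext_def frag_extend_add frag_extend_diff frag_extend_minus)

lemma ext_closed:
  assumes b: "b \<in> carrier B" and x: "x \<in> carrier F" shows "ext b x \<in> carrier F"
proof -
  from x have "Poly_Mapping.keys x \<subseteq> carrier N \<times> carrier M" by simp
  then show ?thesis
  proof (rule free_Abelian_group_induct)
    fix x y assume "ext b x \<in> carrier F" "ext b y \<in> carrier F"
    then show "ext b (x - y) \<in> carrier F" by (simp only: ext_simps F_diff_closed)
  qed (use b in \<open>auto simp: N.smult_closed\<close>)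
qed

lemma ext_rels:
  assumes b: "b \<in> carrier B" and x: "x \<in> T" shows "ext b x \<in> T"
proof -
  have gen: "ext b y \<in> gens" if "y \<in> gens" for y
    using that b unfolding gens_def
    by (elim UnE CollectE exE conjE; simp add: N.smult_r_distr smult_rsmult)
      (use N.smult_closed in blast)+
  from x show ?thesis unfolding rels_eq
  proof (induction rule: generate.induct)
    case one
    show ?case using generate.one[of F gens] by simp
  next
    case (incl y)
    show ?case by (rule generate.incl[OF gen[OF incl]])
  next
    case (inv y)
    have "y \<in> carrier F" using inv gens_subset by blast
    then have "ext b (inv\<^bsub>F\<^esub> y) = inv\<^bsub>F\<^esub> ext b y"
      using ext_closed[OF b \<open>y \<in> carrier F\<close>] by simp
    then show ?case using generate.inv[OF gen[OF inv], of F] by simp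
  next
    case (eng y z)
    show ?case using generate.eng[OF eng(3,4)] by simp
  qed
qed

text \<open>The extension \<open>ext b\<close> maps \<open>T\<close> into \<open>T\<close>, so the image of the coset \<open>T + x\<close> lies in
\<open>T + ext b x\<close> and contains \<open>ext b x\<close>; adding \<open>T\<close> fills the coset up.\<close>

lemma smult_coset:
  assumes b: "b \<in> carrier B" and x: "x \<in> carrier F"
  shows "b \<odot>\<^bsub>Q\<^esub> (T #>\<^bsub>F\<^esub> x) = T #>\<^bsub>F\<^esub> ext b x"
proof -
  have "b \<odot>\<^bsub>Q\<^esub> (T #>\<^bsub>F\<^esub> x) = T <#>\<^bsub>F\<^esub> ext b ` (T #>\<^bsub>F\<^esub> x)"
    by (simp add: tensor_def Let_def ext_def)
  also have "\<dots> = T #>\<^bsub>F\<^esub> ext b x"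
  proof (intro equalityI subsetI)
    fix y assume "y \<in> T <#>\<^bsub>F\<^esub> ext b ` (T #>\<^bsub>F\<^esub> x)"
    then obtain s t where st: "s \<in> T" "t \<in> T" "y = s + ext b (t + x)"
      by (auto simp: set_mult_def r_coset_def)
    have "s + ext b t \<in> T"
      using T.m_closed[OF st(1) ext_rels[OF b st(2)]] by simp
    then show "y \<in> T #>\<^bsub>F\<^esub> ext b x"
      using st(3) by (auto simp: r_coset_def add.assoc intro!: bexI[of _ "s + ext b t"])
  next
    fix y assume "y \<in> T #>\<^bsub>F\<^esub> ext b x"
    then obtain t where t: "t \<in> T" "y = t + ext b x" by (auto simp: r_coset_def)
    have "x \<in> T #>\<^bsub>F\<^esub> x" using F.rcos_self[OF x subgroup_rels] .
    with t show "y \<in> T <#>\<^bsub>F\<^esub> ext b ` (T #>\<^bsub>F\<^esub> x)"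
      by (auto simp: set_mult_def)
  qed
  finally show ?thesis .
qed

lemma smult_pure:
  "b \<in> carrier B \<Longrightarrow> n \<in> carrier N \<Longrightarrow> m \<in> carrier M \<Longrightarrow> b \<odot>\<^bsub>Q\<^esub> (n \<boxtimes> m) = (b \<odot>\<^bsub>N\<^esub> n) \<boxtimes> m"
  by (simp add: pure_tensor_def smult_coset)

lemma smult_tensor_closed: "b \<in> carrier B \<Longrightarrow> t \<in> carrier Q \<Longrightarrow> b \<odot>\<^bsub>Q\<^esub> t \<in> carrier Q"
  by (auto simp: carrier_tensor smult_coset simp del: carrier_free_Abelian_group_iff
      intro!: imageI ext_closed)

lemma smult_tensor_add:
  assumes "b \<in> carrier B" "s \<in> carrier Q" "t \<in> carrier Q"
  shows "b \<odot>\<^bsub>Q\<^esub> (s \<oplus>\<^bsub>Q\<^esub> t) = b \<odot>\<^bsub>Q\<^esub> s \<oplus>\<^bsub>Q\<^esub> b \<odot>\<^bsub>Q\<^esub> t"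
  using assms
  by (auto simp: carrier_tensor smult_coset coset_add ext_closed F_add_closed
      simp del: carrier_free_Abelian_group_iff)

lemma smult_tensor_zero: "b \<in> carrier B \<Longrightarrow> b \<odot>\<^bsub>Q\<^esub> \<zero>\<^bsub>Q\<^esub> = \<zero>\<^bsub>Q\<^esub>"
  using smult_coset[of b 0] by (simp add: coset_zero)

text \<open>The action is additive in \<open>t\<close>, so the axioms have to be checked on pure tensors only, where they are those
of \<open>N\<close>.\<close>

theorem left_module_tensor: "left_module B Q"
proof (intro left_module.intro left_module_axioms.intro)
  show "ring B" ..
  show "abelian_group Q" ..
  fix b t assume b: "b \<in> carrier B" and t: "t \<in> carrier Q"
  show "b \<odot>\<^bsub>Q\<^esub> t \<in> carrier Q" using b t by (rule smult_tensor_closed)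
  show "b \<odot>\<^bsub>Q\<^esub> (t \<oplus>\<^bsub>Q\<^esub> s) = b \<odot>\<^bsub>Q\<^esub> t \<oplus>\<^bsub>Q\<^esub> b \<odot>\<^bsub>Q\<^esub> s" if "s \<in> carrier Q" for s
    using b t that by (rule smult_tensor_add)
  fix c assume c: "c \<in> carrier B"
  from t show "(b \<oplus>\<^bsub>B\<^esub> c) \<odot>\<^bsub>Q\<^esub> t = b \<odot>\<^bsub>Q\<^esub> t \<oplus>\<^bsub>Q\<^esub> c \<odot>\<^bsub>Q\<^esub> t"
  proof (induction rule: tensor_induct)
    case (add s t)
    with b c show ?case
      by (simp add: smult_tensor_add smult_tensor_closed Q.a_ac)
  qed (use b c in \<open>simp_all add: smult_tensor_zero smult_pure N.smult_l_distr N.smult_closed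
      pure_add_left\<close>)
  from t show "(b \<otimes>\<^bsub>B\<^esub> c) \<odot>\<^bsub>Q\<^esub> t = b \<odot>\<^bsub>Q\<^esub> (c \<odot>\<^bsub>Q\<^esub> t)"
    by (induction rule: tensor_induct)
      (use b c in \<open>simp_all add: smult_tensor_zero smult_pure N.smult_assoc N.smult_closed
        smult_tensor_add smult_tensor_closed\<close>)
next
  show "\<one>\<^bsub>B\<^esub> \<odot>\<^bsub>Q\<^esub> t = t" if "t \<in> carrier Q" for t
    using that
    by (induction rule: tensor_induct)
      (simp_all add: smult_tensor_zero smult_pure N.smult_one smult_tensor_add)
qed

end


section \<open>Direct sums and restriction\<close>

text \<open>The group ring is additively generated by the elements \<open>r \<cdot> g\<close>, so linearity of an additive map has to
be tested on these scalars only.\<close>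

lemma (in finite_group_ring) left_module_homI:
  assumes M: "left_module RG M" and N: "left_module RG N"
    and f: "f \<in> additive_hom M N"
    and single: "\<And>g r x. g \<in> carrier G \<Longrightarrow> r \<in> carrier R \<Longrightarrow> x \<in> carrier M \<Longrightarrow>
      f (gr_single R G g r \<odot>\<^bsub>M\<^esub> x) = gr_single R G g r \<odot>\<^bsub>N\<^esub> f x"
  shows "f \<in> left_module_hom RG M N"
proof -
  interpret M: left_module RG M by fact
  interpret N: left_module RG N by fact
  note f_simps = additive_hom_closed[OF f] additive_hom_add[OF f]
    additive_hom_zero[OF M.abelian_group_axioms N.abelian_group_axioms f]
  have "f (a \<odot>\<^bsub>M\<^esub> x) = a \<odot>\<^bsub>N\<^esub> f x" if "a \<in> carrier RG" "x \<in> carrier M" for a x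
    using that
    by (induction a rule: group_ring_induct)
      (simp_all add: single f_simps M.smult_l_distr N.smult_l_distr M.smult_closed)
  then show ?thesis
    by (auto simp: left_module_hom_def f_simps)
qed

lemma direct_sum_simps:
  "\<zero>\<^bsub>direct_sum I M\<^esub> = (\<lambda>i\<in>I. \<zero>\<^bsub>M i\<^esub>)"
  "u \<oplus>\<^bsub>direct_sum I M\<^esub> v = (\<lambda>i\<in>I. u i \<oplus>\<^bsub>M i\<^esub> v i)"
  "a \<odot>\<^bsub>direct_sum I M\<^esub> u = (\<lambda>i\<in>I. a \<odot>\<^bsub>M i\<^esub> u i)"
  by (simp_all add: direct_sum_def)

lemma direct_sumI:
  assumes "\<And>i. i \<in> I \<Longrightarrow> u i \<in> carrier (M i)" "finite {i \<in> I. u i \<noteq> \<zero>\<^bsub>M i\<^esub>}"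
  shows "(\<lambda>i\<in>I. u i) \<in> carrier (direct_sum I M)"
proof -
  have "{i \<in> I. (\<lambda>i\<in>I. u i) i \<noteq> \<zero>\<^bsub>M i\<^esub>} = {i \<in> I. u i \<noteq> \<zero>\<^bsub>M i\<^esub>}" by auto
  with assms show ?thesis by (auto simp: direct_sum_def)
qed

lemma direct_sumD:
  assumes "u \<in> carrier (direct_sum I M)"
  shows "i \<in> I \<Longrightarrow> u i \<in> carrier (M i)" "finite {i \<in> I. u i \<noteq> \<zero>\<^bsub>M i\<^esub>}" "(\<lambda>i\<in>I. u i) = u"
  using assms by (auto simp: direct_sum_def PiE_iff extensional_restrict)

lemma left_module_direct_sum:
  assumes R: "ring R" and M: "\<And>i. i \<in> I \<Longrightarrow> left_module R (M i)"
  shows "left_module R (direct_sum I M)"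
proof -
  have ab: "abelian_group (M i)" if "i \<in> I" for i
    using M[OF that] by (simp add: left_module_def)
  interpret R: ring R by fact
  let ?D = "direct_sum I M"
  have add: "u \<oplus>\<^bsub>?D\<^esub> v \<in> carrier ?D" if u: "u \<in> carrier ?D" and v: "v \<in> carrier ?D" for u v
    unfolding direct_sum_simps
  proof (rule direct_sumI)
    show "u i \<oplus>\<^bsub>M i\<^esub> v i \<in> carrier (M i)" if "i \<in> I" for i
      using abelian_group.axioms(1)[OF ab[OF that]] direct_sumD(1)[OF u that] direct_sumD(1)[OF v that]
      by (rule abelian_monoid.a_closed)
    have "u i = \<zero>\<^bsub>M i\<^esub> \<Longrightarrow> v i = \<zero>\<^bsub>M i\<^esub> \<Longrightarrow> u i \<oplus>\<^bsub>M i\<^esub> v i = \<zero>\<^bsub>M i\<^esub>" if "i \<in> I" for i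
      using abelian_group.axioms(1)[OF ab[OF that]] by (simp add: abelian_monoid.l_zero abelian_monoid.zero_closed)
    then have "{i \<in> I. u i \<oplus>\<^bsub>M i\<^esub> v i \<noteq> \<zero>\<^bsub>M i\<^esub>} \<subseteq> {i \<in> I. u i \<noteq> \<zero>\<^bsub>M i\<^esub>} \<union> {i \<in> I. v i \<noteq> \<zero>\<^bsub>M i\<^esub>}"
      by auto
    then show "finite {i \<in> I. u i \<oplus>\<^bsub>M i\<^esub> v i \<noteq> \<zero>\<^bsub>M i\<^esub>}"
      using direct_sumD(2)[OF u] direct_sumD(2)[OF v] by (auto intro: finite_subset)
  qed
  have smult: "a \<odot>\<^bsub>?D\<^esub> u \<in> carrier ?D" if a: "a \<in> carrier R" and u: "u \<in> carrier ?D" for a u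
    unfolding direct_sum_simps
  proof (rule direct_sumI)
    show "a \<odot>\<^bsub>M i\<^esub> u i \<in> carrier (M i)" if "i \<in> I" for i
      using left_module.smult_closed[OF M[OF that] a direct_sumD(1)[OF u that]] .
    have "u i = \<zero>\<^bsub>M i\<^esub> \<Longrightarrow> a \<odot>\<^bsub>M i\<^esub> u i = \<zero>\<^bsub>M i\<^esub>" if "i \<in> I" for i
      using left_module.smult_r_null[OF M[OF that] a] by simp
    then have "{i \<in> I. a \<odot>\<^bsub>M i\<^esub> u i \<noteq> \<zero>\<^bsub>M i\<^esub>} \<subseteq> {i \<in> I. u i \<noteq> \<zero>\<^bsub>M i\<^esub>}"
      by auto
    then show "finite {i \<in> I. a \<odot>\<^bsub>M i\<^esub> u i \<noteq> \<zero>\<^bsub>M i\<^esub>}"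
      using direct_sumD(2)[OF u] by (rule finite_subset)
  qed
  have zero: "\<zero>\<^bsub>?D\<^esub> \<in> carrier ?D"
    unfolding direct_sum_simps
    by (rule direct_sumI) (use ab in \<open>auto simp: abelian_group_def abelian_monoid.zero_closed\<close>)
  have "abelian_group ?D"
  proof (rule abelian_groupI)
    fix u assume u: "u \<in> carrier ?D"
    define v where "v = (\<lambda>i\<in>I. \<ominus>\<^bsub>M i\<^esub> u i)"
    have "v \<in> carrier ?D"
      unfolding v_def
    proof (rule direct_sumI)
      show "\<ominus>\<^bsub>M i\<^esub> u i \<in> carrier (M i)" if "i \<in> I" for i
        using ab[OF that] direct_sumD(1)[OF u that] by (rule abelian_group.a_inv_closed)
      have "u i = \<zero>\<^bsub>M i\<^esub> \<Longrightarrow> \<ominus>\<^bsub>M i\<^esub> u i = \<zero>\<^bsub>M i\<^esub>" if "i \<in> I" for i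
      proof -
        interpret abelian_group "M i" using that by (rule ab)
        show "u i = \<zero>\<^bsub>M i\<^esub> \<Longrightarrow> \<ominus>\<^bsub>M i\<^esub> u i = \<zero>\<^bsub>M i\<^esub>" by (simp add: minus_zero)
      qed
      then have "{i \<in> I. \<ominus>\<^bsub>M i\<^esub> u i \<noteq> \<zero>\<^bsub>M i\<^esub>} \<subseteq> {i \<in> I. u i \<noteq> \<zero>\<^bsub>M i\<^esub>}"
        by auto
      then show "finite {i \<in> I. \<ominus>\<^bsub>M i\<^esub> u i \<noteq> \<zero>\<^bsub>M i\<^esub>}"
        using direct_sumD(2)[OF u] by (rule finite_subset)
    qed
    moreover have "v \<oplus>\<^bsub>?D\<^esub> u = \<zero>\<^bsub>?D\<^esub>"
      unfolding direct_sum_simps v_def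
      by (rule restrict_ext) (use ab direct_sumD(1)[OF u] in \<open>simp add: abelian_group.l_neg\<close>)
    ultimately show "\<exists>v\<in>carrier ?D. v \<oplus>\<^bsub>?D\<^esub> u = \<zero>\<^bsub>?D\<^esub>" by blast
    show "\<zero>\<^bsub>?D\<^esub> \<oplus>\<^bsub>?D\<^esub> u = u"
      unfolding direct_sum_simps
      by (subst (2) direct_sumD(3)[OF u, symmetric], rule restrict_ext)
        (use ab direct_sumD(1)[OF u] in \<open>simp add: abelian_group_def abelian_monoid.l_zero\<close>)
    fix v assume v: "v \<in> carrier ?D"
    show "u \<oplus>\<^bsub>?D\<^esub> v = v \<oplus>\<^bsub>?D\<^esub> u"
      unfolding direct_sum_simps
      by (rule restrict_ext)
        (use ab direct_sumD(1)[OF u] direct_sumD(1)[OF v]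
          in \<open>simp add: abelian_group_def abelian_monoid.a_comm\<close>)
    fix w assume w: "w \<in> carrier ?D"
    show "u \<oplus>\<^bsub>?D\<^esub> v \<oplus>\<^bsub>?D\<^esub> w = u \<oplus>\<^bsub>?D\<^esub> (v \<oplus>\<^bsub>?D\<^esub> w)"
      unfolding direct_sum_simps
      by (rule restrict_ext)
        (use ab direct_sumD(1)[OF u] direct_sumD(1)[OF v] direct_sumD(1)[OF w]
          in \<open>simp add: abelian_group_def abelian_monoid.a_assoc\<close>)
  qed (simp_all add: add zero)
  moreover have "left_module_axioms R ?D"
  proof
    fix a u assume a: "a \<in> carrier R" and u: "u \<in> carrier ?D"
    show "a \<odot>\<^bsub>?D\<^esub> u \<in> carrier ?D" using a u by (rule smult)
    show "a \<odot>\<^bsub>?D\<^esub> (u \<oplus>\<^bsub>?D\<^esub> v) = a \<odot>\<^bsub>?D\<^esub> u \<oplus>\<^bsub>?D\<^esub> a \<odot>\<^bsub>?D\<^esub> v" if v: "v \<in> carrier ?D" for v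
      unfolding direct_sum_simps
      by (rule restrict_ext)
        (use left_module.smult_r_distr[OF M a direct_sumD(1)[OF u] direct_sumD(1)[OF v]] in simp)
    fix b assume b: "b \<in> carrier R"
    show "(a \<oplus>\<^bsub>R\<^esub> b) \<odot>\<^bsub>?D\<^esub> u = a \<odot>\<^bsub>?D\<^esub> u \<oplus>\<^bsub>?D\<^esub> b \<odot>\<^bsub>?D\<^esub> u"
      unfolding direct_sum_simps
      by (rule restrict_ext) (use left_module.smult_l_distr[OF M a b direct_sumD(1)[OF u]] in simp)
    show "(a \<otimes>\<^bsub>R\<^esub> b) \<odot>\<^bsub>?D\<^esub> u = a \<odot>\<^bsub>?D\<^esub> (b \<odot>\<^bsub>?D\<^esub> u)"
      unfolding direct_sum_simps
      by (rule restrict_ext) (use left_module.smult_assoc[OF M a b direct_sumD(1)[OF u]] in simp)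
  next
    fix u assume u: "u \<in> carrier ?D"
    show "\<one>\<^bsub>R\<^esub> \<odot>\<^bsub>?D\<^esub> u = u"
      unfolding direct_sum_simps
      by (subst (2) direct_sumD(3)[OF u, symmetric], rule restrict_ext)
        (use left_module.smult_one[OF M direct_sumD(1)[OF u]] in simp)
  qed
  ultimately show ?thesis using R by (simp add: left_module_def)
qed

lemma Res_simps [simp]:
  "carrier (Res R G G\<^sub>1 \<phi> V) = carrier V" "\<zero>\<^bsub>Res R G G\<^sub>1 \<phi> V\<^esub> = \<zero>\<^bsub>V\<^esub>"
  "x \<oplus>\<^bsub>Res R G G\<^sub>1 \<phi> V\<^esub> y = x \<oplus>\<^bsub>V\<^esub> y"
  "a \<odot>\<^bsub>Res R G G\<^sub>1 \<phi> V\<^esub> x = group_ring_map R G G\<^sub>1 \<phi> a \<odot>\<^bsub>V\<^esub> x"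
  by (simp_all add: Res_def)

text \<open>The module axioms carry over because the extension of \<open>\<phi>\<close> to the group rings is a ring homomorphism.\<close>

lemma (in finite_group_ring_hom) left_module_Res:
  assumes "left_module B.RG V" shows "left_module A.RG (Res R G G\<^sub>1 \<phi> V)"
proof -
  interpret V: left_module B.RG V by fact
  have "abelian_group (Res R G G\<^sub>1 \<phi> V)"
  proof (rule abelian_groupI)
    fix x assume "x \<in> carrier (Res R G G\<^sub>1 \<phi> V)"
    then show "\<exists>y\<in>carrier (Res R G G\<^sub>1 \<phi> V). y \<oplus>\<^bsub>Res R G G\<^sub>1 \<phi> V\<^esub> x = \<zero>\<^bsub>Res R G G\<^sub>1 \<phi> V\<^esub>"
      by (intro bexI[of _ "\<ominus>\<^bsub>V\<^esub> x"]) (simp_all add: V.l_neg)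
  qed (simp_all add: V.a_ac)
  moreover have "left_module_axioms A.RG (Res R G G\<^sub>1 \<phi> V)"
    by unfold_locales
      (simp_all add: group_ring_map_add group_ring_map_mult group_ring_map_one V.smult_closed
        V.smult_l_distr V.smult_r_distr V.smult_assoc V.smult_one)
  ultimately show ?thesis using A.ring_group_ring by (simp add: left_module_def)
qed


section \<open>Induction\<close>

locale group_ring_induction = finite_group_ring_hom R G G\<^sub>1 \<phi> + V: left_module "group_ring R G" V
  for R :: "('r, 'm) ring_scheme" and G :: "('g, 'n) monoid_scheme"
    and G\<^sub>1 :: "('h, 'o) monoid_scheme" and \<phi> and V :: "('g \<Rightarrow> 'r, 'v, 'w) module_scheme"

text \<open>The element \<open>g \<otimes> v\<close> of the induced module. Computations take place with these elements, not with the
pure tensors \<open>a \<otimes> v\<close> for arbitrary \<open>a\<close> in the group ring.\<close>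

definition ind_elem ::
  "('r, 'm) ring_scheme \<Rightarrow> ('g, 'n) monoid_scheme \<Rightarrow> ('h, 'o) monoid_scheme \<Rightarrow> ('g \<Rightarrow> 'h)
    \<Rightarrow> ('g \<Rightarrow> 'r, 'v, 'w) module_scheme \<Rightarrow> 'h \<Rightarrow> 'v \<Rightarrow> (('h \<Rightarrow> 'r) \<times> 'v \<Rightarrow>\<^sub>0 int) set"
  where "ind_elem R G G\<^sub>1 \<phi> V g v =
    pure_tensor (group_ring R G) (group_ring_bimodule R G G\<^sub>1 \<phi>) V (gr_single R G\<^sub>1 g \<one>\<^bsub>R\<^esub>) v"

context group_ring_induction
begin

abbreviation "N \<equiv> group_ring_bimodule R G G\<^sub>1 \<phi>"
abbreviation "IV \<equiv> Ind R G G\<^sub>1 \<phi> V"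
abbreviation "ind \<equiv> ind_elem R G G\<^sub>1 \<phi> V"
abbreviation act (infixr \<open>\<bullet>\<close> 75) where "g \<bullet> v \<equiv> gr_single R G g \<one>\<^bsub>R\<^esub> \<odot>\<^bsub>V\<^esub> v"
abbreviation scale (infixr \<open>\<star>\<close> 75) where "r \<star> v \<equiv> gr_single R G \<one>\<^bsub>G\<^esub> r \<odot>\<^bsub>V\<^esub> v"

lemma bimodule_simps [simp]:
  "carrier N = carrier B.RG" "\<zero>\<^bsub>N\<^esub> = \<zero>\<^bsub>B.RG\<^esub>" "a \<oplus>\<^bsub>N\<^esub> b = a \<oplus>\<^bsub>B.RG\<^esub> b"
  "a \<odot>\<^bsub>N\<^esub> b = a \<otimes>\<^bsub>B.RG\<^esub> b" "rsmult N a c = a \<otimes>\<^bsub>B.RG\<^esub> group_ring_map R G G\<^sub>1 \<phi> c"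
  by (simp_all add: group_ring_bimodule_def)

lemma left_module_bimodule: "left_module B.RG N"
proof -
  have "abelian_group N"
  proof (rule abelian_groupI)
    fix a assume "a \<in> carrier N"
    then show "\<exists>b\<in>carrier N. b \<oplus>\<^bsub>N\<^esub> a = \<zero>\<^bsub>N\<^esub>"
      by (intro bexI[of _ "\<ominus>\<^bsub>B.RG\<^esub> a"]) (simp_all add: B.A.l_neg)
  qed (simp_all add: B.A.a_ac)
  moreover have "left_module_axioms B.RG N"
    by unfold_locales (simp_all add: B.A.l_distr B.A.r_distr B.A.m_assoc)
  ultimately show ?thesis using B.ring_group_ring by (simp add: left_module_def)
qed

sublocale N: left_module B.RG N by (rule left_module_bimodule)

sublocale T: bimodule_tensor A.RG B.RG N V
  rewrites "tensor A.RG N V = IV"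
proof -
  show "bimodule_tensor A.RG B.RG N V"
    by unfold_locales (simp_all add: B.A.m_assoc)
qed (simp add: Ind_def)

lemma left_module_Ind: "left_module B.RG IV"
  by (rule T.left_module_tensor)

lemma abelian_group_Ind: "abelian_group IV"
  by (rule T.abelian_group_tensor)

lemma ind_closed [simp]: "g \<in> carrier G\<^sub>1 \<Longrightarrow> v \<in> carrier V \<Longrightarrow> ind g v \<in> carrier IV"
  unfolding ind_elem_def by (rule T.pure_closed) simp_all

lemma ind_add:
  "g \<in> carrier G\<^sub>1 \<Longrightarrow> v \<in> carrier V \<Longrightarrow> w \<in> carrier V \<Longrightarrow>
    ind g (v \<oplus>\<^bsub>V\<^esub> w) = ind g v \<oplus>\<^bsub>IV\<^esub> ind g w"
  unfolding ind_elem_def by (rule T.pure_add_right) simp_all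

text \<open>The coefficient crosses the tensor sign: \<open>r \<cdot> g = g (r \<cdot> 1)\<close>, and \<open>r \<cdot> 1\<close> is the image of the element
\<open>r \<cdot> 1\<close> of the group ring of \<open>G\<close>.\<close>

lemma pure_single:
  assumes "g \<in> carrier G\<^sub>1" "r \<in> carrier R" "v \<in> carrier V"
  shows "pure_tensor A.RG N V (gr_single R G\<^sub>1 g r) v = ind g (r \<star> v)"
proof -
  have "gr_single R G\<^sub>1 g r = rsmult N (gr_single R G\<^sub>1 g \<one>\<^bsub>R\<^esub>) (gr_single R G \<one>\<^bsub>G\<^esub> r)"
    using assms by (simp add: group_ring_map_single B.single_mult)
  then show ?thesis
    unfolding ind_elem_def using assms by (simp only:) (rule T.pure_balanced; simp)
qed

lemma ind_balanced:
  assumes "g \<in> carrier G\<^sub>1" "k \<in> carrier G" "v \<in> carrier V"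
  shows "ind (g \<otimes>\<^bsub>G\<^sub>1\<^esub> \<phi> k) v = ind g (k \<bullet> v)"
proof -
  have "gr_single R G\<^sub>1 (g \<otimes>\<^bsub>G\<^sub>1\<^esub> \<phi> k) \<one>\<^bsub>R\<^esub> = rsmult N (gr_single R G\<^sub>1 g \<one>\<^bsub>R\<^esub>) (gr_single R G k \<one>\<^bsub>R\<^esub>)"
    using assms by (simp add: group_ring_map_single B.single_mult)
  then show ?thesis
    unfolding ind_elem_def using assms by (simp only:) (rule T.pure_balanced; simp)
qed

lemma smult_ind:
  assumes "h \<in> carrier G\<^sub>1" "r \<in> carrier R" "g \<in> carrier G\<^sub>1" "v \<in> carrier V"
  shows "gr_single R G\<^sub>1 h r \<odot>\<^bsub>IV\<^esub> ind g v = ind (h \<otimes>\<^bsub>G\<^sub>1\<^esub> g) (r \<star> v)"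
  using assms T.smult_pure[of "gr_single R G\<^sub>1 h r" "gr_single R G\<^sub>1 g \<one>\<^bsub>R\<^esub>" v]
  by (simp add: ind_elem_def[of _ _ _ _ _ g] B.single_mult pure_single)

text \<open>By \<open>pure_single\<close>, every pure tensor \<open>a \<otimes> v\<close> is a sum of elements \<open>g \<otimes> v'\<close>.\<close>

lemma Ind_induct [consumes 1, case_names zero ind add]:
  assumes t: "t \<in> carrier IV"
    and zero: "P \<zero>\<^bsub>IV\<^esub>"
    and ind: "\<And>g v. g \<in> carrier G\<^sub>1 \<Longrightarrow> v \<in> carrier V \<Longrightarrow> P (ind g v)"
    and add: "\<And>s t. s \<in> carrier IV \<Longrightarrow> t \<in> carrier IV \<Longrightarrow> P s \<Longrightarrow> P t \<Longrightarrow> P (s \<oplus>\<^bsub>IV\<^esub> t)"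
  shows "P t"
  using t
proof (induction t rule: T.tensor_induct)
  case (pure a v)
  then have "a \<in> carrier B.RG" by simp
  then show ?case
  proof (induction a rule: B.group_ring_induct)
    case zero
    then show ?case using T.pure_zero_left[OF \<open>v \<in> _\<close>] assms(2) by simp
  next
    case (single g r)
    then show ?case using \<open>v \<in> _\<close> by (simp add: pure_single ind V.smult_closed)
  next
    case (add a b)
    then show ?case using T.pure_add_left[of a b v] \<open>v \<in> _\<close> by (simp add: assms(4))
  qed
qed (use zero add in auto)

text \<open>The universal property of induction in terms of group elements. Coefficients from \<open>R\<close> impose no condition
on \<open>f\<close>, as they can always be moved into the second argument. So the relations between the elements
\<open>g \<otimes> v\<close> are additivity in \<open>v\<close> and \<open>g \<phi>(k) \<otimes> v = g \<otimes> k v\<close>.\<close>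

lemma Ind_lift:
  assumes P: "abelian_group P"
    and f: "\<And>g v. g \<in> carrier G\<^sub>1 \<Longrightarrow> v \<in> carrier V \<Longrightarrow> f g v \<in> carrier P"
    and f_add: "\<And>g v w. g \<in> carrier G\<^sub>1 \<Longrightarrow> v \<in> carrier V \<Longrightarrow> w \<in> carrier V \<Longrightarrow>
      f g (v \<oplus>\<^bsub>V\<^esub> w) = f g v \<oplus>\<^bsub>P\<^esub> f g w"
    and f_balanced: "\<And>g k v. g \<in> carrier G\<^sub>1 \<Longrightarrow> k \<in> carrier G \<Longrightarrow> v \<in> carrier V \<Longrightarrow>
      f (g \<otimes>\<^bsub>G\<^sub>1\<^esub> \<phi> k) v = f g (k \<bullet> v)"
  obtains h where "h \<in> additive_hom IV P"
    "\<And>g v. g \<in> carrier G\<^sub>1 \<Longrightarrow> v \<in> carrier V \<Longrightarrow> h (ind g v) = f g v"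
proof -
  interpret P: abelian_group P by fact
  have f_zero: "f g \<zero>\<^bsub>V\<^esub> = \<zero>\<^bsub>P\<^esub>" if "g \<in> carrier G\<^sub>1" for g
    using f_add[OF that, of "\<zero>\<^bsub>V\<^esub>" "\<zero>\<^bsub>V\<^esub>"] f[OF that, of "\<zero>\<^bsub>V\<^esub>"] P.add.l_cancel_one' by auto
  \<comment> \<open>\<open>a\<close> is the sum of the \<open>g (a\<^sub>g \<cdot> 1)\<close>, so \<open>a \<otimes> v\<close> is the sum of the \<open>g \<otimes> a\<^sub>g v\<close>\<close>
  define e where "e a v = (\<Oplus>\<^bsub>P\<^esub>g\<in>carrier G\<^sub>1. f g (a g \<star> v))" for a v
  have e_closed: "e a v \<in> carrier P" if "a \<in> carrier B.RG" "v \<in> carrier V" for a v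
    using that by (auto simp: e_def intro!: P.finsum_closed f V.smult_closed)
  have e_add_left: "e (a \<oplus>\<^bsub>B.RG\<^esub> b) v = e a v \<oplus>\<^bsub>P\<^esub> e b v"
    if "a \<in> carrier B.RG" "b \<in> carrier B.RG" "v \<in> carrier V" for a b v
    using that unfolding e_def
    by (subst P.finsum_addf[symmetric])
      (auto intro!: P.finsum_cong' f V.smult_closed P.a_closed
        simp: B.group_ring_add_apply A.single_add V.smult_l_distr f_add V.smult_closed)
  have e_add_right: "e a (v \<oplus>\<^bsub>V\<^esub> w) = e a v \<oplus>\<^bsub>P\<^esub> e a w"
    if "a \<in> carrier B.RG" "v \<in> carrier V" "w \<in> carrier V" for a v w
    using that unfolding e_def
    by (subst P.finsum_addf[symmetric])
      (auto intro!: P.finsum_cong' f V.smult_closed P.a_closed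
        simp: V.smult_r_distr f_add V.smult_closed)
  have scale_zero: "\<zero>\<^bsub>R\<^esub> \<star> v = \<zero>\<^bsub>V\<^esub>" if "v \<in> carrier V" for v
  proof -
    have "gr_single R G \<one>\<^bsub>G\<^esub> \<zero>\<^bsub>R\<^esub> = \<zero>\<^bsub>A.RG\<^esub>"
      by (auto simp: gr_single_def group_ring_def)
    then show ?thesis using that by simp
  qed
  have e_single: "e (gr_single R G\<^sub>1 g r) v = f g (r \<star> v)"
    if "g \<in> carrier G\<^sub>1" "r \<in> carrier R" "v \<in> carrier V" for g r v
  proof -
    have "e (gr_single R G\<^sub>1 g r) v = (\<Oplus>\<^bsub>P\<^esub>h\<in>carrier G\<^sub>1. if g = h then f h (r \<star> v) else \<zero>\<^bsub>P\<^esub>)"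
      unfolding e_def using that
      by (intro P.finsum_cong')
        (auto simp: B.single_apply scale_zero f_zero intro!: f V.smult_closed)
    also have "\<dots> = f g (r \<star> v)"
      using that B.finite_carrier
      by (intro P.finsum_singleton) (auto intro!: f V.smult_closed)
    finally show ?thesis .
  qed
  have e_zero_left: "e \<zero>\<^bsub>B.RG\<^esub> v = \<zero>\<^bsub>P\<^esub>" if "v \<in> carrier V" for v
    using e_add_left[of "\<zero>\<^bsub>B.RG\<^esub>" "\<zero>\<^bsub>B.RG\<^esub>" v] e_closed[of "\<zero>\<^bsub>B.RG\<^esub>" v] that
      P.add.l_cancel_one' by auto
  have e_zero_right: "e a \<zero>\<^bsub>V\<^esub> = \<zero>\<^bsub>P\<^esub>" if "a \<in> carrier B.RG" for a
    using e_add_right[of a "\<zero>\<^bsub>V\<^esub>" "\<zero>\<^bsub>V\<^esub>"] e_closed[of a "\<zero>\<^bsub>V\<^esub>"] that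
      P.add.l_cancel_one' by auto
  have e_balanced: "e (a \<otimes>\<^bsub>B.RG\<^esub> group_ring_map R G G\<^sub>1 \<phi> c) v = e a (c \<odot>\<^bsub>V\<^esub> v)"
    if "a \<in> carrier B.RG" "c \<in> carrier A.RG" "v \<in> carrier V" for a c v
    using that(1)
  proof (induction a rule: B.group_ring_induct)
    case (single g r)
    from that(2) show ?case
    proof (induction c rule: A.group_ring_induct)
      case (single k s)
      show ?case
        using single \<open>g \<in> _\<close> \<open>r \<in> _\<close> \<open>v \<in> _\<close>
        by (simp add: group_ring_map_single B.single_mult e_single f_balanced
            A.single_mult V.smult_closed flip: V.smult_assoc)
    qed (use single \<open>v \<in> _\<close> in \<open>simp_all add: e_zero_left e_zero_right group_ring_map_add
        B.group_ring_r_distr e_add_left e_add_right V.smult_l_distr V.smult_closed\<close>)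
  qed (use that in \<open>simp_all add: e_zero_left e_add_left B.group_ring_l_distr V.smult_closed\<close>)
  obtain h where h: "h \<in> additive_hom IV P"
    "\<And>a v. a \<in> carrier N \<Longrightarrow> v \<in> carrier V \<Longrightarrow> h (pure_tensor A.RG N V a v) = e a v"
    by (rule T.tensor_lift[OF P, of e])
      (auto simp: e_closed e_add_left e_add_right e_balanced)
  show thesis
  proof (rule that[OF h(1)])
    fix g v assume "g \<in> carrier G\<^sub>1" "v \<in> carrier V"
    then show "h (ind g v) = f g v"
      by (simp add: ind_elem_def h(2) e_single V.smult_one flip: A.one_eq_single)
  qed
qed

end


section \<open>The double coset formula\<close>

locale mackey =
  R: cring R + G: group G + K: group K + H: group H + \<alpha>: group_hom K G \<alpha> + \<beta>: group_hom H G \<beta> +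
  V: left_module "group_ring R K" V
  for R :: "('r, 'rx) ring_scheme" and G :: "('g, 'gx) monoid_scheme"
    and K :: "('k, 'kx) monoid_scheme" and H :: "('h, 'hx) monoid_scheme"
    and \<alpha> :: "'k \<Rightarrow> 'g" and \<beta> :: "'h \<Rightarrow> 'g" and V :: "('k \<Rightarrow> 'r, 'v, 'vx) module_scheme" +
  assumes finite_G: "finite (carrier G)" and finite_K: "finite (carrier K)"
    and finite_H: "finite (carrier H)"
begin

abbreviation "RH \<equiv> group_ring R H"

sublocale gK: finite_group_ring R K by unfold_locales (rule finite_K)
sublocale gH: finite_group_ring R H by unfold_locales (rule finite_H)

sublocale ind: group_ring_induction R K G \<alpha> V
  by unfold_locales (rule finite_G)

sublocale res: finite_group_ring_hom R H G \<beta>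
  by unfold_locales

abbreviation "B x \<equiv> pullback K H (conj_hom G x \<alpha>) \<beta>"
abbreviation "VB x \<equiv> Res R (B x) K fst V"
abbreviation "W x \<equiv> Ind R (B x) H snd (VB x)"
abbreviation "ind_at x \<equiv> ind_elem R (B x) H snd (VB x)"

lemma pullback_simps:
  "(k, h) \<in> carrier (B x) \<longleftrightarrow>
    k \<in> carrier K \<and> h \<in> carrier H \<and> x \<otimes>\<^bsub>G\<^esub> \<alpha> k \<otimes>\<^bsub>G\<^esub> inv\<^bsub>G\<^esub> x = \<beta> h"
  "p \<otimes>\<^bsub>B x\<^esub> q = (fst p \<otimes>\<^bsub>K\<^esub> fst q, snd p \<otimes>\<^bsub>H\<^esub> snd q)"
  "\<one>\<^bsub>B x\<^esub> = (\<one>\<^bsub>K\<^esub>, \<one>\<^bsub>H\<^esub>)"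
  by (auto simp: pullback_def conj_hom_def mult_DirProd' one_DirProd)

text \<open>As \<open>k \<mapsto> x \<alpha>(k) x\<^bsup>-1\<^esup>\<close> and \<open>\<beta>\<close> are homomorphisms, the pairs on which they agree form a subgroup of
\<open>K \<times> H\<close>.\<close>

lemma group_pullback:
  assumes x: "x \<in> carrier G" shows "group (B x)"
proof -
  interpret KH: group "K \<times>\<times> H" by (rule DirProd_group) unfold_locales
  have conj_mult: "x \<otimes>\<^bsub>G\<^esub> (\<alpha> k \<otimes>\<^bsub>G\<^esub> \<alpha> k') \<otimes>\<^bsub>G\<^esub> inv\<^bsub>G\<^esub> x =
      (x \<otimes>\<^bsub>G\<^esub> \<alpha> k \<otimes>\<^bsub>G\<^esub> inv\<^bsub>G\<^esub> x) \<otimes>\<^bsub>G\<^esub> (x \<otimes>\<^bsub>G\<^esub> \<alpha> k' \<otimes>\<^bsub>G\<^esub> inv\<^bsub>G\<^esub> x)"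
    if "k \<in> carrier K" "k' \<in> carrier K" for k k'
    using that x by (simp add: G.m_assoc G.inv_solve_left G.inv_solve_left')
  have "subgroup (carrier (B x)) (K \<times>\<times> H)"
  proof (rule KH.subgroupI)
    show "carrier (B x) \<subseteq> carrier (K \<times>\<times> H)"
      by (auto simp: pullback_simps)
    have "(\<one>\<^bsub>K\<^esub>, \<one>\<^bsub>H\<^esub>) \<in> carrier (B x)"
      using x by (simp add: pullback_simps)
    then show "carrier (B x) \<noteq> {}" by blast
  next
    fix p assume "p \<in> carrier (B x)"
    then obtain k h where p: "p = (k, h)" "(k, h) \<in> carrier (B x)" by (cases p) auto
    then have kh: "k \<in> carrier K" "h \<in> carrier H" "x \<otimes>\<^bsub>G\<^esub> \<alpha> k \<otimes>\<^bsub>G\<^esub> inv\<^bsub>G\<^esub> x = \<beta> h"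
      by (simp_all add: pullback_simps)
    have "x \<otimes>\<^bsub>G\<^esub> \<alpha> (inv\<^bsub>K\<^esub> k) \<otimes>\<^bsub>G\<^esub> inv\<^bsub>G\<^esub> x = inv\<^bsub>G\<^esub> (x \<otimes>\<^bsub>G\<^esub> \<alpha> k \<otimes>\<^bsub>G\<^esub> inv\<^bsub>G\<^esub> x)"
      using kh(1) x by (simp add: G.inv_mult_group G.m_assoc)
    with kh show "inv\<^bsub>K \<times>\<times> H\<^esub> p \<in> carrier (B x)"
      by (simp add: p(1) pullback_simps inv_DirProd[OF K.is_group H.is_group])
  next
    fix p q assume "p \<in> carrier (B x)" "q \<in> carrier (B x)"
    then show "p \<otimes>\<^bsub>K \<times>\<times> H\<^esub> q \<in> carrier (B x)"
      by (cases p; cases q) (simp add: pullback_simps conj_mult)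
  qed
  then have "group ((K \<times>\<times> H)\<lparr>carrier := carrier (B x)\<rparr>)"
    by (rule KH.subgroup_imp_group)
  moreover have "(K \<times>\<times> H)\<lparr>carrier := carrier (B x)\<rparr> = B x"
    by (simp add: pullback_def)
  ultimately show ?thesis by simp
qed

lemma pullback_induction:
  assumes x: "x \<in> carrier G"
  shows "finite_group_ring_hom R (B x) K fst" "group_ring_induction R (B x) H snd (VB x)"
proof -
  interpret B: group "B x" by (rule group_pullback[OF x])
  have "carrier (B x) \<subseteq> carrier K \<times> carrier H"
    by (auto simp: pullback_simps)
  then have "finite (carrier (B x))"
    using finite_K finite_H by (auto intro: finite_subset)
  then interpret fB: finite_group_ring R "B x" by unfold_locales
  have "fst \<in> hom (B x) K" "snd \<in> hom (B x) H"
    by (auto simp: hom_def pullback_simps)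
  then interpret fst: finite_group_ring_hom R "B x" K fst + snd: finite_group_ring_hom R "B x" H snd
    by unfold_locales
  show "finite_group_ring_hom R (B x) K fst" ..
  interpret VB: left_module fB.RG "VB x"
    by (rule fst.left_module_Res) unfold_locales
  show "group_ring_induction R (B x) H snd (VB x)" ..
qed

lemma left_module_W: "x \<in> carrier G \<Longrightarrow> left_module RH (W x)"
  by (rule group_ring_induction.left_module_Ind[OF pullback_induction(2)])

lemma abelian_group_W: "x \<in> carrier G \<Longrightarrow> abelian_group (W x)"
  by (rule group_ring_induction.abelian_group_Ind[OF pullback_induction(2)])

abbreviation act (infixr \<open>\<bullet>\<close> 75) where "k \<bullet> v \<equiv> gr_single R K k \<one>\<^bsub>R\<^esub> \<odot>\<^bsub>V\<^esub> v"
abbreviation scale (infixr \<open>\<star>\<close> 75) where "r \<star> v \<equiv> gr_single R K \<one>\<^bsub>K\<^esub> r \<odot>\<^bsub>V\<^esub> v"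

lemma act_closed [simp]: "v \<in> carrier V \<Longrightarrow> k \<bullet> v \<in> carrier V"
  by (simp add: V.smult_closed)

lemma scale_closed [simp]: "r \<in> carrier R \<Longrightarrow> v \<in> carrier V \<Longrightarrow> r \<star> v \<in> carrier V"
  by (simp add: V.smult_closed)

lemma act_act:
  "k \<in> carrier K \<Longrightarrow> l \<in> carrier K \<Longrightarrow> v \<in> carrier V \<Longrightarrow> k \<bullet> l \<bullet> v = (k \<otimes>\<^bsub>K\<^esub> l) \<bullet> v"
  by (simp add: gK.single_mult flip: V.smult_assoc)

lemma act_one [simp]: "v \<in> carrier V \<Longrightarrow> \<one>\<^bsub>K\<^esub> \<bullet> v = v"
  by (simp add: V.smult_one flip: gK.one_eq_single)

lemma act_scale:
  "k \<in> carrier K \<Longrightarrow> r \<in> carrier R \<Longrightarrow> v \<in> carrier V \<Longrightarrow> k \<bullet> r \<star> v = r \<star> k \<bullet> v"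
  by (simp add: gK.single_mult flip: V.smult_assoc)

lemma ind_at_closed [simp]:
  "x \<in> carrier G \<Longrightarrow> h \<in> carrier H \<Longrightarrow> v \<in> carrier V \<Longrightarrow> ind_at x h v \<in> carrier (W x)"
  by (rule group_ring_induction.ind_closed[OF pullback_induction(2)]) simp_all

lemma ind_at_add:
  "x \<in> carrier G \<Longrightarrow> h \<in> carrier H \<Longrightarrow> v \<in> carrier V \<Longrightarrow> w \<in> carrier V \<Longrightarrow>
    ind_at x h (v \<oplus>\<^bsub>V\<^esub> w) = ind_at x h v \<oplus>\<^bsub>W x\<^esub> ind_at x h w"
  using group_ring_induction.ind_add[OF pullback_induction(2), of x h v w] by simp

text \<open>An element \<open>(k, l)\<close> of the pullback moves from the left factor, where it acts through \<open>l\<close>, to the right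
factor, where it acts through \<open>k\<close>.\<close>

lemma ind_at_balanced:
  assumes "x \<in> carrier G" "h \<in> carrier H" "(k, l) \<in> carrier (B x)" "v \<in> carrier V"
  shows "ind_at x (h \<otimes>\<^bsub>H\<^esub> l) v = ind_at x h (k \<bullet> v)"
  using group_ring_induction.ind_balanced[OF pullback_induction(2), of x h "(k, l)" v] assms
  by (simp add: finite_group_ring_hom.group_ring_map_single[OF pullback_induction(1)])

lemma smult_ind_at:
  assumes "x \<in> carrier G" "l \<in> carrier H" "r \<in> carrier R" "h \<in> carrier H" "v \<in> carrier V"
  shows "gr_single R H l r \<odot>\<^bsub>W x\<^esub> ind_at x h v = ind_at x (l \<otimes>\<^bsub>H\<^esub> h) (r \<star> v)"
proof -
  have "\<one>\<^bsub>B x\<^esub> \<in> carrier (B x)"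
    using group_pullback[OF assms(1)] by (simp add: group.is_monoid monoid.one_closed)
  then show ?thesis
    using group_ring_induction.smult_ind[OF pullback_induction(2), of x l r h v] assms
    by (simp add: finite_group_ring_hom.group_ring_map_single[OF pullback_induction(1)] pullback_simps(3))
qed

lemma W_induct [consumes 2, case_names zero ind add]:
  assumes x: "x \<in> carrier G" and w: "w \<in> carrier (W x)"
    and zero: "P \<zero>\<^bsub>W x\<^esub>"
    and ind: "\<And>h v. h \<in> carrier H \<Longrightarrow> v \<in> carrier V \<Longrightarrow> P (ind_at x h v)"
    and add: "\<And>s t. s \<in> carrier (W x) \<Longrightarrow> t \<in> carrier (W x) \<Longrightarrow> P s \<Longrightarrow> P t \<Longrightarrow> P (s \<oplus>\<^bsub>W x\<^esub> t)"
  shows "P w"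
  using group_ring_induction.Ind_induct[OF pullback_induction(2)[OF x] w, of P] zero ind add
  by simp

lemma W_lift:
  assumes x: "x \<in> carrier G" and P: "abelian_group P"
    and f: "\<And>h v. h \<in> carrier H \<Longrightarrow> v \<in> carrier V \<Longrightarrow> f h v \<in> carrier P"
    and f_add: "\<And>h v w. h \<in> carrier H \<Longrightarrow> v \<in> carrier V \<Longrightarrow> w \<in> carrier V \<Longrightarrow>
      f h (v \<oplus>\<^bsub>V\<^esub> w) = f h v \<oplus>\<^bsub>P\<^esub> f h w"
    and f_balanced: "\<And>h k l v. h \<in> carrier H \<Longrightarrow> (k, l) \<in> carrier (B x) \<Longrightarrow> v \<in> carrier V \<Longrightarrow>
      f (h \<otimes>\<^bsub>H\<^esub> l) v = f h (k \<bullet> v)"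
  obtains p where "p \<in> additive_hom (W x) P"
    "\<And>h v. h \<in> carrier H \<Longrightarrow> v \<in> carrier V \<Longrightarrow> p (ind_at x h v) = f h v"
proof (rule group_ring_induction.Ind_lift[OF pullback_induction(2)[OF x] P, of f])
  fix h b v assume *: "h \<in> carrier H" "b \<in> carrier (B x)" "v \<in> carrier (VB x)"
  obtain k l where b: "b = (k, l)" by (cases b)
  show "f (h \<otimes>\<^bsub>H\<^esub> snd b) v = f h (gr_single R (B x) b \<one>\<^bsub>R\<^esub> \<odot>\<^bsub>VB x\<^esub> v)"
    using * f_balanced[of h k l v] x
    by (simp add: b finite_group_ring_hom.group_ring_map_single[OF pullback_induction(1)])
qed (use f f_add that in auto)

text \<open>The witnesses that \<open>g\<close> lies in the double coset of \<open>x\<close>. The pair \<open>(h, k)\<close> is an argument, because the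
projection to the summand of \<open>x\<close> is computed from it.\<close>

definition decomposes :: "'g \<Rightarrow> 'g \<Rightarrow> 'h \<times> 'k \<Rightarrow> bool" where
  "decomposes x g = (\<lambda>(h, k). h \<in> carrier H \<and> k \<in> carrier K \<and> g = \<beta> h \<otimes>\<^bsub>G\<^esub> x \<otimes>\<^bsub>G\<^esub> \<alpha> k)"

text \<open>The value at \<open>g \<otimes> v\<close> of the projection to the summand of \<open>x\<close>: it is \<open>h \<otimes> k v\<close> if
\<open>g = \<beta>(h) x \<alpha>(k)\<close>, and zero if \<open>g\<close> lies outside the double coset of \<open>x\<close>. By \<open>decomposes_unique\<close> the
choice of \<open>h\<close> and \<open>k\<close> does not matter.\<close>

definition coset_proj :: "'g \<Rightarrow> 'g \<Rightarrow> 'v \<Rightarrow> (('h \<Rightarrow> 'r) \<times> 'v \<Rightarrow>\<^sub>0 int) set" where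
  "coset_proj x g v =
    (if Ex (decomposes x g) then (case SOME p. decomposes x g p of (h, k) \<Rightarrow> ind_at x h (k \<bullet> v))
     else \<zero>\<^bsub>W x\<^esub>)"

text \<open>This is where the pullback comes from. If \<open>\<beta>(h) x \<alpha>(k) = \<beta>(h') x \<alpha>(k')\<close>, then
\<open>x \<alpha>(k' k\<^bsup>-1\<^esup>) x\<^bsup>-1\<^esup> = \<beta>(h'\<^bsup>-1\<^esup> h)\<close>, so that \<open>(k' k\<^bsup>-1\<^esup>, h'\<^bsup>-1\<^esup> h)\<close> lies in \<open>B\<^sub>x\<close> and
\<open>h \<otimes> k v = h' (h'\<^bsup>-1\<^esup> h) \<otimes> k v = h' \<otimes> (k' k\<^bsup>-1\<^esup>) k v = h' \<otimes> k' v\<close>.\<close>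

lemma decomposes_unique:
  assumes x: "x \<in> carrier G" and v: "v \<in> carrier V"
    and 1: "decomposes x g (h, k)" and 2: "decomposes x g (h', k')"
  shows "ind_at x h (k \<bullet> v) = ind_at x h' (k' \<bullet> v)"
proof -
  have c: "h \<in> carrier H" "k \<in> carrier K" "h' \<in> carrier H" "k' \<in> carrier K"
    and eq: "\<beta> h \<otimes>\<^bsub>G\<^esub> x \<otimes>\<^bsub>G\<^esub> \<alpha> k = \<beta> h' \<otimes>\<^bsub>G\<^esub> x \<otimes>\<^bsub>G\<^esub> \<alpha> k'"
    using 1 2 by (auto simp: decomposes_def)
  let ?l = "inv\<^bsub>H\<^esub> h' \<otimes>\<^bsub>H\<^esub> h" and ?m = "k' \<otimes>\<^bsub>K\<^esub> inv\<^bsub>K\<^esub> k"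
  have "x \<otimes>\<^bsub>G\<^esub> \<alpha> ?m \<otimes>\<^bsub>G\<^esub> inv\<^bsub>G\<^esub> x
      = inv\<^bsub>G\<^esub> \<beta> h' \<otimes>\<^bsub>G\<^esub> (\<beta> h' \<otimes>\<^bsub>G\<^esub> x \<otimes>\<^bsub>G\<^esub> \<alpha> k') \<otimes>\<^bsub>G\<^esub> inv\<^bsub>G\<^esub> \<alpha> k \<otimes>\<^bsub>G\<^esub> inv\<^bsub>G\<^esub> x"
    using c x by (simp add: G.m_assoc G.inv_solve_left)
  also have "\<dots> = \<beta> ?l"
    unfolding eq[symmetric] using c x by (simp add: G.m_assoc)
  finally have "(?m, ?l) \<in> carrier (B x)"
    using c by (simp add: pullback_simps)
  then have "ind_at x (h' \<otimes>\<^bsub>H\<^esub> ?l) (k \<bullet> v) = ind_at x h' (?m \<bullet> k \<bullet> v)"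
    using c x v by (intro ind_at_balanced) auto
  then show ?thesis
    using c v by (simp add: act_act K.m_assoc flip: H.m_assoc)
qed

lemma coset_proj_decomposes:
  assumes "x \<in> carrier G" "v \<in> carrier V" "decomposes x g (h, k)"
  shows "coset_proj x g v = ind_at x h (k \<bullet> v)"
proof -
  obtain h' k' where p: "(SOME p. decomposes x g p) = (h', k')" by (cases "SOME p. decomposes x g p")
  have "decomposes x g (h', k')"
    unfolding p[symmetric] using assms(3) by (rule someI)
  then have "ind_at x h' (k' \<bullet> v) = ind_at x h (k \<bullet> v)"
    using assms by (intro decomposes_unique)
  moreover have "\<exists>p. decomposes x g p"
    using assms(3) by (rule exI)
  ultimately show ?thesis
    by (simp only: coset_proj_def p if_True prod.case)
qed

lemma coset_proj_zero: "\<nexists>p. decomposes x g p \<Longrightarrow> coset_proj x g v = \<zero>\<^bsub>W x\<^esub>"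
  by (simp add: coset_proj_def)

lemma decomposes_mult:
  assumes "x \<in> carrier G" "l \<in> carrier H" "m \<in> carrier K" "decomposes x g (h, k)"
  shows "decomposes x (\<beta> l \<otimes>\<^bsub>G\<^esub> g \<otimes>\<^bsub>G\<^esub> \<alpha> m) (l \<otimes>\<^bsub>H\<^esub> h, k \<otimes>\<^bsub>K\<^esub> m)"
  using assms by (auto simp: decomposes_def G.m_assoc)

lemma decomposes_mult_iff:
  assumes x: "x \<in> carrier G" and g: "g \<in> carrier G" and l: "l \<in> carrier H" and m: "m \<in> carrier K"
  shows "(\<exists>p. decomposes x (\<beta> l \<otimes>\<^bsub>G\<^esub> g \<otimes>\<^bsub>G\<^esub> \<alpha> m) p) \<longleftrightarrow> (\<exists>p. decomposes x g p)"
proof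
  assume "\<exists>p. decomposes x (\<beta> l \<otimes>\<^bsub>G\<^esub> g \<otimes>\<^bsub>G\<^esub> \<alpha> m) p"
  then obtain h k where "decomposes x (\<beta> l \<otimes>\<^bsub>G\<^esub> g \<otimes>\<^bsub>G\<^esub> \<alpha> m) (h, k)" by auto
  from decomposes_mult[OF x _ _ this, of "inv\<^bsub>H\<^esub> l" "inv\<^bsub>K\<^esub> m"] l m
  have "Ex (decomposes x (\<beta> (inv\<^bsub>H\<^esub> l) \<otimes>\<^bsub>G\<^esub> (\<beta> l \<otimes>\<^bsub>G\<^esub> g \<otimes>\<^bsub>G\<^esub> \<alpha> m) \<otimes>\<^bsub>G\<^esub> \<alpha> (inv\<^bsub>K\<^esub> m)))"
    by blast
  also have "\<beta> (inv\<^bsub>H\<^esub> l) \<otimes>\<^bsub>G\<^esub> (\<beta> l \<otimes>\<^bsub>G\<^esub> g \<otimes>\<^bsub>G\<^esub> \<alpha> m) \<otimes>\<^bsub>G\<^esub> \<alpha> (inv\<^bsub>K\<^esub> m) = g"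
    using g l m by (simp add: G.m_assoc) (simp flip: G.m_assoc)
  finally show "\<exists>p. decomposes x g p" .
qed (use decomposes_mult[OF x l m] in \<open>metis surj_pair\<close>)

text \<open>Equivariance on both sides at once. With \<open>l = 1\<close> and \<open>r = 1\<close> this is the balancing condition for
\<open>Ind_lift\<close>, and with \<open>m = 1\<close> it is linearity over the group ring of \<open>H\<close>.\<close>

lemma coset_proj_mult:
  assumes "x \<in> carrier G" "g \<in> carrier G" "l \<in> carrier H" "r \<in> carrier R" "m \<in> carrier K"
    "v \<in> carrier V"
  shows "coset_proj x (\<beta> l \<otimes>\<^bsub>G\<^esub> g \<otimes>\<^bsub>G\<^esub> \<alpha> m) (r \<star> v) = gr_single R H l r \<odot>\<^bsub>W x\<^esub> coset_proj x g (m \<bullet> v)"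
proof (cases "\<exists>p. decomposes x g p")
  case True
  then obtain h k where hk: "decomposes x g (h, k)" by auto
  then have "h \<in> carrier H" "k \<in> carrier K" by (auto simp: decomposes_def)
  with assms hk show ?thesis
    by (simp add: coset_proj_decomposes[OF _ _ decomposes_mult] coset_proj_decomposes smult_ind_at
        act_act act_scale)
next
  case False
  then show ?thesis
    using assms decomposes_mult_iff[of x g l m]
    by (simp add: coset_proj_zero left_module.smult_r_null[OF left_module_W])
qed

lemma coset_proj_closed:
  assumes x: "x \<in> carrier G" and v: "v \<in> carrier V"
  shows "coset_proj x g v \<in> carrier (W x)"
proof (cases "\<exists>p. decomposes x g p")
  case True
  then obtain h k where hk: "decomposes x g (h, k)" by auto
  then have "h \<in> carrier H" "k \<in> carrier K" by (auto simp: decomposes_def)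
  with hk x v show ?thesis by (simp add: coset_proj_decomposes)
next
  case False
  then show ?thesis
    using abelian_group_W[OF x] by (simp add: coset_proj_zero abelian_group_def abelian_monoid.zero_closed)
qed

lemma coset_proj_add:
  assumes x: "x \<in> carrier G" and v: "v \<in> carrier V" and w: "w \<in> carrier V"
  shows "coset_proj x g (v \<oplus>\<^bsub>V\<^esub> w) = coset_proj x g v \<oplus>\<^bsub>W x\<^esub> coset_proj x g w"
proof (cases "\<exists>p. decomposes x g p")
  case True
  then obtain h k where hk: "decomposes x g (h, k)" by auto
  then have "h \<in> carrier H" "k \<in> carrier K" by (auto simp: decomposes_def)
  with hk x v w show ?thesis
    by (simp add: coset_proj_decomposes V.smult_r_distr ind_at_add)
next
  case False
  then show ?thesis
    using abelian_group_W[OF x]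
    by (simp add: coset_proj_zero abelian_group_def abelian_monoid.l_zero abelian_monoid.zero_closed)
qed

abbreviation "IV \<equiv> Ind R K G \<alpha> V"
abbreviation "ind_G \<equiv> ind_elem R K G \<alpha> V"

lemma double_coset_projection:
  assumes x: "x \<in> carrier G"
  obtains p where "p \<in> left_module_hom RH (Res R H G \<beta> IV) (W x)"
    "\<And>g v. g \<in> carrier G \<Longrightarrow> v \<in> carrier V \<Longrightarrow> p (ind_G g v) = coset_proj x g v"
proof -
  interpret W: left_module RH "W x" by (rule left_module_W[OF x])
  have bal: "coset_proj x (g \<otimes>\<^bsub>G\<^esub> \<alpha> k) v = coset_proj x g (k \<bullet> v)"
    if "g \<in> carrier G" "k \<in> carrier K" "v \<in> carrier V" for g k v
    using coset_proj_mult[of x g "\<one>\<^bsub>H\<^esub>" "\<one>\<^bsub>R\<^esub>" k v] x that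
    by (simp add: coset_proj_closed W.smult_one flip: gH.one_eq_single)
  obtain p where p: "p \<in> additive_hom IV (W x)"
    "\<And>g v. g \<in> carrier G \<Longrightarrow> v \<in> carrier V \<Longrightarrow> p (ind_G g v) = coset_proj x g v"
    by (rule ind.Ind_lift[OF abelian_group_W[OF x], of "coset_proj x"])
      (use x in \<open>auto simp: coset_proj_closed coset_proj_add bal\<close>)
  interpret I: left_module ind.B.RG IV by (rule ind.left_module_Ind)
  note p_simps = additive_hom_closed[OF p(1)] additive_hom_add[OF p(1)]
    additive_hom_zero[OF ind.abelian_group_Ind abelian_group_W[OF x] p(1)]
  have "p \<in> left_module_hom RH (Res R H G \<beta> IV) (W x)"
  proof (rule gH.left_module_homI[OF res.left_module_Res[OF ind.left_module_Ind] left_module_W[OF x]])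
    show "p \<in> additive_hom (Res R H G \<beta> IV) (W x)"
      using p(1) by (simp add: hom_def)
    fix h r u assume h: "h \<in> carrier H" and r: "r \<in> carrier R" and "u \<in> carrier (Res R H G \<beta> IV)"
    then have "u \<in> carrier IV" by simp
    then show "p (gr_single R H h r \<odot>\<^bsub>Res R H G \<beta> IV\<^esub> u) = gr_single R H h r \<odot>\<^bsub>W x\<^esub> p u"
    proof (induction u rule: ind.Ind_induct)
      case (ind g v)
      with h r coset_proj_mult[OF x ind(1) h r K.one_closed ind(2)] show ?case
        by (simp add: res.group_ring_map_single ind.smult_ind p(2))
    qed (use h r in \<open>simp_all add: p_simps res.group_ring_map_single I.smult_r_distr
        W.smult_r_distr I.smult_closed\<close>)
  qed
  with p(2) show thesis using that by blast
qed

text \<open>The map \<open>h \<otimes> v \<mapsto> \<beta>(h) x \<otimes> v\<close> is balanced over \<open>B\<^sub>x\<close>: if \<open>\<beta>(l) = x \<alpha>(k) x\<^bsup>-1\<^esup>\<close>, then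
\<open>\<beta>(h l) x \<otimes> v = \<beta>(h) x \<alpha>(k) \<otimes> v = \<beta>(h) x \<otimes> k v\<close>.\<close>

lemma double_coset_inclusion:
  assumes x: "x \<in> carrier G"
  obtains i where "i \<in> additive_hom (W x) IV"
    "\<And>h v. h \<in> carrier H \<Longrightarrow> v \<in> carrier V \<Longrightarrow> i (ind_at x h v) = ind_G (\<beta> h \<otimes>\<^bsub>G\<^esub> x) v"
proof (rule W_lift[OF x ind.abelian_group_Ind, of "\<lambda>h v. ind_G (\<beta> h \<otimes>\<^bsub>G\<^esub> x) v"])
  fix h k l v assume *: "h \<in> carrier H" "(k, l) \<in> carrier (B x)" "v \<in> carrier V"
  then have kl: "k \<in> carrier K" "l \<in> carrier H" "\<beta> l = x \<otimes>\<^bsub>G\<^esub> \<alpha> k \<otimes>\<^bsub>G\<^esub> inv\<^bsub>G\<^esub> x"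
    by (simp_all add: pullback_simps)
  have "\<beta> (h \<otimes>\<^bsub>H\<^esub> l) \<otimes>\<^bsub>G\<^esub> x = \<beta> h \<otimes>\<^bsub>G\<^esub> x \<otimes>\<^bsub>G\<^esub> \<alpha> k"
    using * kl x by (simp add: G.m_assoc)
  then show "ind_G (\<beta> (h \<otimes>\<^bsub>H\<^esub> l) \<otimes>\<^bsub>G\<^esub> x) v = ind_G (\<beta> h \<otimes>\<^bsub>G\<^esub> x) (k \<bullet> v)"
    using * kl x ind.ind_balanced[of "\<beta> h \<otimes>\<^bsub>G\<^esub> x" k v] by simp
qed (use x that in \<open>auto simp: ind.ind_add\<close>)

text \<open>Lying in the same double coset is a symmetric relation, so the unique representative in the double coset
of \<open>g\<close> is the unique representative whose double coset contains \<open>g\<close>.\<close>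

lemma double_coset_reps_decomposes:
  assumes S: "double_coset_reps G (\<beta> ` carrier H) (\<alpha> ` carrier K) S" and g: "g \<in> carrier G"
  shows "\<exists>!x. x \<in> S \<and> (\<exists>p. decomposes x g p)"
proof -
  let ?D = "(\<beta> ` carrier H #>\<^bsub>G\<^esub> g) <#>\<^bsub>G\<^esub> (\<alpha> ` carrier K)"
  have SG: "S \<subseteq> carrier G" and "\<exists>!x. x \<in> S \<inter> ?D"
    using S g by (auto simp: double_coset_reps_def double_cosets_def)
  moreover have "x \<in> ?D \<longleftrightarrow> (\<exists>p. decomposes x g p)" if "x \<in> S" for x
  proof -
    have x: "x \<in> carrier G" using that SG by blast
    have "x \<in> ?D \<longleftrightarrow> (\<exists>p. decomposes g x p)"
      by (auto simp: decomposes_def set_mult_def r_coset_def)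
    also have "\<dots> \<longleftrightarrow> (\<exists>p. decomposes x g p)"
    proof -
      have "\<exists>p. decomposes z y p" if "y \<in> carrier G" "z \<in> carrier G" "decomposes y z (h, k)" for y z h k
      proof -
        have hk: "h \<in> carrier H" "k \<in> carrier K" "z = \<beta> h \<otimes>\<^bsub>G\<^esub> y \<otimes>\<^bsub>G\<^esub> \<alpha> k"
          using that by (auto simp: decomposes_def)
        then have "decomposes z y (inv\<^bsub>H\<^esub> h, inv\<^bsub>K\<^esub> k)"
          using that by (simp add: decomposes_def G.m_assoc) (simp flip: G.m_assoc)
        then show ?thesis ..
      qed
      then show ?thesis using x g by fastforce
    qed
    finally show ?thesis .
  qed
  ultimately show ?thesis by (metis IntD1 IntD2 IntI)
qed

text \<open>The projections are linear and the inclusions are additive. As the two families are inverse to each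
other, the tuple of all projections is a bijective linear map onto the direct sum.\<close>

theorem mackey_formula:
  assumes S: "double_coset_reps G (\<beta> ` carrier H) (\<alpha> ` carrier K) S"
  shows "left_module_isomorphic RH (Res R H G \<beta> IV) (direct_sum S W)"
proof -
  let ?D = "direct_sum S W" and ?Res = "Res R H G \<beta> IV"
  have SG: "x \<in> S \<Longrightarrow> x \<in> carrier G" for x
    using S by (auto simp: double_coset_reps_def)
  have "S \<subseteq> carrier G" using SG by blast
  then have fin: "finite S" using finite_G by (rule finite_subset)
  have "\<forall>x\<in>S. \<exists>p. p \<in> left_module_hom RH ?Res (W x) \<and>
      (\<forall>g\<in>carrier G. \<forall>v\<in>carrier V. p (ind_G g v) = coset_proj x g v)"
    using double_coset_projection[OF SG] by metis
  then obtain p where p_hom: "\<And>x. x \<in> S \<Longrightarrow> p x \<in> left_module_hom RH ?Res (W x)"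
    and p: "\<And>x g v. x \<in> S \<Longrightarrow> g \<in> carrier G \<Longrightarrow> v \<in> carrier V \<Longrightarrow> p x (ind_G g v) = coset_proj x g v"
    by (metis (mono_tags, lifting))
  have "\<forall>x\<in>S. \<exists>i. i \<in> additive_hom (W x) IV \<and>
      (\<forall>h\<in>carrier H. \<forall>v\<in>carrier V. i (ind_at x h v) = ind_G (\<beta> h \<otimes>\<^bsub>G\<^esub> x) v)"
    using double_coset_inclusion[OF SG] by metis
  then obtain i where i_hom: "\<And>x. x \<in> S \<Longrightarrow> i x \<in> additive_hom (W x) IV"
    and i: "\<And>x h v. x \<in> S \<Longrightarrow> h \<in> carrier H \<Longrightarrow> v \<in> carrier V \<Longrightarrow>
      i x (ind_at x h v) = ind_G (\<beta> h \<otimes>\<^bsub>G\<^esub> x) v"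
    by (metis (mono_tags, lifting))
  have p_additive: "p x \<in> additive_hom IV (W x)" if "x \<in> S" for x
    using p_hom[OF that] by (simp add: left_module_hom_def hom_def)
  \<comment> \<open>on generators, the mixed terms vanish because \<open>\<beta>(h) x\<close> lies in no other double coset\<close>
  have p_i: "p y (i x w) = (if x = y then w else \<zero>\<^bsub>W y\<^esub>)"
    if x: "x \<in> S" and y: "y \<in> S" and w: "w \<in> carrier (W x)" for x y w
  proof -
    interpret Wy: abelian_group "W y" by (rule abelian_group_W[OF SG[OF y]])
    note simps = additive_hom_closed[OF i_hom[OF x]]
      additive_hom_add[OF i_hom[OF x]] additive_hom_add[OF p_additive[OF y]]
      additive_hom_zero[OF abelian_group_W[OF SG[OF x]] ind.abelian_group_Ind i_hom[OF x]]
      additive_hom_zero[OF ind.abelian_group_Ind abelian_group_W[OF SG[OF y]] p_additive[OF y]]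
    from SG[OF x] w show ?thesis
    proof (induction w rule: W_induct)
      case (ind h v)
      note h = ind(1) and v = ind(2)
      let ?g = "\<beta> h \<otimes>\<^bsub>G\<^esub> x"
      have g: "?g \<in> carrier G" using h SG[OF x] by simp
      have f: "decomposes x ?g (h, \<one>\<^bsub>K\<^esub>)"
        using h SG[OF x] by (simp add: decomposes_def)
      show ?case
      proof (cases "x = y")
        case True
        with f h v x y g show ?thesis by (simp add: i p coset_proj_decomposes SG)
      next
        case False
        then have "\<nexists>q. decomposes y ?g q"
          using double_coset_reps_decomposes[OF S g] f x y by blast
        with False h v x y g show ?thesis by (simp add: i p coset_proj_zero)
      qed
    qed (auto simp: simps)
  qed
  \<comment> \<open>only the double coset that contains \<open>g\<close> contributes to the sum at \<open>g \<otimes> v\<close>\<close>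
  have i_p: "(\<Oplus>\<^bsub>IV\<^esub>x\<in>S. i x (p x u)) = u" if "u \<in> carrier IV" for u
    using that
  proof (induction u rule: ind.Ind_induct)
    case zero
    have "i x (p x \<zero>\<^bsub>IV\<^esub>) = \<zero>\<^bsub>IV\<^esub>" if "x \<in> S" for x
      using additive_hom_zero[OF abelian_group_W[OF SG[OF that]] ind.abelian_group_Ind i_hom[OF that]]
        additive_hom_zero[OF ind.abelian_group_Ind abelian_group_W[OF SG[OF that]] p_additive[OF that]]
      by simp
    then show ?case by (simp cong: ind.T.Q.finsum_cong)
  next
    case (ind g v)
    then obtain x where x: "x \<in> S" "\<exists>q. decomposes x g q"
      and uniq: "\<And>y. y \<in> S \<Longrightarrow> \<exists>q. decomposes y g q \<Longrightarrow> y = x"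
      using double_coset_reps_decomposes[OF S ind(1)] by blast
    from x(2) obtain h k where hk: "decomposes x g (h, k)" by (metis surj_pair)
    then have c: "h \<in> carrier H" "k \<in> carrier K" "g = \<beta> h \<otimes>\<^bsub>G\<^esub> x \<otimes>\<^bsub>G\<^esub> \<alpha> k" by (auto simp: decomposes_def)
    have "i y (p y (ind_G g v)) = (if x = y then ind_G g v else \<zero>\<^bsub>IV\<^esub>)" if y: "y \<in> S" for y
    proof (cases "x = y")
      case True
      have "i x (p x (ind_G g v)) = ind_G (\<beta> h \<otimes>\<^bsub>G\<^esub> x) (k \<bullet> v)"
        using x(1) hk c ind by (simp add: p i coset_proj_decomposes SG)
      also have "\<dots> = ind_G g v"
        using c ind SG[OF x(1)] ind.ind_balanced[of "\<beta> h \<otimes>\<^bsub>G\<^esub> x" k v] by simp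
      finally show ?thesis using True by simp
    next
      case False
      with uniq y have "\<nexists>q. decomposes y g q" by blast
      with False y ind show ?thesis
        using additive_hom_zero[OF abelian_group_W[OF SG[OF y]] ind.abelian_group_Ind i_hom[OF y]]
        by (simp add: p coset_proj_zero)
    qed
    then have "(\<Oplus>\<^bsub>IV\<^esub>y\<in>S. i y (p y (ind_G g v))) = (\<Oplus>\<^bsub>IV\<^esub>y\<in>S. if x = y then ind_G g v else \<zero>\<^bsub>IV\<^esub>)"
      using ind by (intro ind.T.Q.finsum_cong') auto
    also have "\<dots> = ind_G g v"
      using x(1) fin ind by (intro ind.T.Q.finsum_singleton) auto
    finally show ?case .
  next
    case (add s t)
    have ip: "i x (p x u) \<in> carrier IV" if "x \<in> S" "u \<in> carrier IV" for x u
      using that i_hom p_additive by (metis additive_hom_closed)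
    have "i x (p x (s \<oplus>\<^bsub>IV\<^esub> t)) = i x (p x s) \<oplus>\<^bsub>IV\<^esub> i x (p x t)" if "x \<in> S" for x
      using add that
      by (simp add: additive_hom_add[OF p_additive] additive_hom_add[OF i_hom]
          additive_hom_closed[OF p_additive])
    then have "(\<Oplus>\<^bsub>IV\<^esub>x\<in>S. i x (p x (s \<oplus>\<^bsub>IV\<^esub> t))) = (\<Oplus>\<^bsub>IV\<^esub>x\<in>S. i x (p x s) \<oplus>\<^bsub>IV\<^esub> i x (p x t))"
      using add ip by (intro ind.T.Q.finsum_cong') auto
    also have "\<dots> = s \<oplus>\<^bsub>IV\<^esub> t"
      using add ip by (subst ind.T.Q.finsum_addf) auto
    finally show ?case .
  qed
  define P where "P u = (\<lambda>x\<in>S. p x u)" for u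
  have P_closed: "P u \<in> carrier ?D" if "u \<in> carrier IV" for u
    unfolding P_def
    by (rule direct_sumI) (use additive_hom_closed[OF p_additive that] fin in simp_all)
  have "P \<in> left_module_hom RH ?Res ?D"
    using p_hom P_closed
    by (auto simp: left_module_hom_def P_def direct_sum_simps intro!: restrict_ext)
  moreover have "bij_betw P (carrier ?Res) (carrier ?D)"
  proof (rule bij_betw_byWitness[where f' = "\<lambda>w. \<Oplus>\<^bsub>IV\<^esub>x\<in>S. i x (w x)"])
    show "\<forall>u\<in>carrier ?Res. (\<Oplus>\<^bsub>IV\<^esub>x\<in>S. i x (P u x)) = u"
    proof
      fix u assume "u \<in> carrier ?Res"
      then have u: "u \<in> carrier IV" by simp
      have "(\<Oplus>\<^bsub>IV\<^esub>x\<in>S. i x (P u x)) = (\<Oplus>\<^bsub>IV\<^esub>x\<in>S. i x (p x u))"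
        using i_hom p_additive u
        by (intro ind.T.Q.finsum_cong') (auto simp: P_def intro: additive_hom_closed)
      with i_p[OF u] show "(\<Oplus>\<^bsub>IV\<^esub>x\<in>S. i x (P u x)) = u" by simp
    qed
    show "\<forall>w\<in>carrier ?D. P (\<Oplus>\<^bsub>IV\<^esub>x\<in>S. i x (w x)) = w"
    proof
      fix w assume w: "w \<in> carrier ?D"
      have "p y (\<Oplus>\<^bsub>IV\<^esub>x\<in>S. i x (w x)) = w y" if y: "y \<in> S" for y
      proof -
        interpret Wy: abelian_group "W y" by (rule abelian_group_W[OF SG[OF y]])
        have "p y (\<Oplus>\<^bsub>IV\<^esub>x\<in>S. i x (w x)) = (\<Oplus>\<^bsub>W y\<^esub>x\<in>S. p y (i x (w x)))"
          using i_hom direct_sumD(1)[OF w]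
          by (intro additive_hom_finsum[OF ind.abelian_group_Ind Wy.abelian_group_axioms p_additive[OF y] fin])
            (auto intro: additive_hom_closed)
        also have "\<dots> = (\<Oplus>\<^bsub>W y\<^esub>x\<in>S. if y = x then w y else \<zero>\<^bsub>W y\<^esub>)"
          using direct_sumD(1)[OF w] p_i y by (intro Wy.finsum_cong') auto
        also have "\<dots> = w y"
          using y fin direct_sumD(1)[OF w] by (intro Wy.finsum_singleton) auto
        finally show ?thesis .
      qed
      then have "P (\<Oplus>\<^bsub>IV\<^esub>x\<in>S. i x (w x)) = (\<lambda>y\<in>S. w y)"
        unfolding P_def by (rule restrict_ext)
      with direct_sumD(3)[OF w] show "P (\<Oplus>\<^bsub>IV\<^esub>x\<in>S. i x (w x)) = w" by simp
    qed
    show "P ` carrier ?Res \<subseteq> carrier ?D"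
      using P_closed by auto
    show "(\<lambda>w. \<Oplus>\<^bsub>IV\<^esub>x\<in>S. i x (w x)) ` carrier ?D \<subseteq> carrier ?Res"
    proof (intro image_subsetI)
      fix w assume w: "w \<in> carrier ?D"
      then show "(\<Oplus>\<^bsub>IV\<^esub>x\<in>S. i x (w x)) \<in> carrier ?Res"
        using additive_hom_closed[OF i_hom direct_sumD(1)[OF w]]
        by (auto intro!: ind.T.Q.finsum_closed)
    qed
  qed
  ultimately show ?thesis
    unfolding left_module_isomorphic_def
    by (intro conjI bexI[of _ P] res.left_module_Res[OF ind.left_module_Ind]
        left_module_direct_sum[OF gH.ring_group_ring left_module_W[OF SG]])
qed

end

theorem theorem3p6:
  fixes R :: "('r, 'rx) ring_scheme"
    and G :: "('g, 'gx) monoid_scheme"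
    and K :: "('k, 'kx) monoid_scheme"
    and H :: "('h, 'hx) monoid_scheme"
    and \<alpha> :: "'k \<Rightarrow> 'g" and \<beta> :: "'h \<Rightarrow> 'g"
    and V :: "('k \<Rightarrow> 'r, 'v, 'vx) module_scheme"
    and S :: "'g set"
  assumes "cring R"
    and "group G" and "finite (carrier G)"
    and "group K" and "finite (carrier K)"
    and "group H" and "finite (carrier H)"
    and "\<alpha> \<in> hom K G" and "\<beta> \<in> hom H G"
    and "left_module (group_ring R K) V"
    and "double_coset_reps G (\<beta> ` carrier H) (\<alpha> ` carrier K) S"
  shows "left_module_isomorphic (group_ring R H)
    (Res R H G \<beta> (Ind R K G \<alpha> V))
    (direct_sum S (\<lambda>x. let B = pullback K H (conj_hom G x \<alpha>) \<beta>
                       in Ind R B H snd (Res R B K fst V)))"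
proof -
  interpret mackey R G K H \<alpha> \<beta> V
    using assms by (simp add: mackey_def mackey_axioms_def group_hom_def group_hom_axioms_def)
  show ?thesis
    unfolding Let_def using assms(11) by (rule mackey_formula)
qed

end
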